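(* Let $H$ be a sufficiently large positive real number and let \[ S(H) = \sum_{1 \le x, y \le H} \mu^2\left(x^2 + y^2 + 1\right), \] where $x, y$ run over positive integers and $\mu$ is the Möbius function. For each positive integer $q$ let $\lambda(q)$ denote the number of pairs of integers $(x,y)$ with $1 \le x, y \le q$ and $x^2 + y^2 + 1 \equiv 0 \pmod{q}$. Then for every $\varepsilon > 0$, \[ S(H) = c H^2 + O\left(H^{\frac{4}{3} + \varepsilon}\right), \qquad\text{where}\qquad c = \prod_{p} \left(1 - \frac{\lambda(p^2)}{p^4}\right), \] the product being over all primes $p$, and the implied constant depends only on $\varepsilon$.
   Context: $\mu^2(n)=1$ if $n$ is squarefree and $0$ otherwise. *)

theory Defs
  imports
    "HOL-Analysis.Infinite_Products"
    "HOL-Number_Theory.Cong"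
    "HOL-Computational_Algebra.Squarefree"
begin

definition moebius :: "nat \<Rightarrow> int" where
  "moebius n = (if squarefree n then (-1) ^ card (prime_factors n) else 0)"

lemma moebius_square: "(moebius n)\<^sup>2 = (if squarefree n then 1 else 0)"
  by (simp add: moebius_def flip: power_mult)

definition sqfree_sum :: "real \<Rightarrow> real" where
  "sqfree_sum H = (\<Sum>(x, y) \<in> {(x, y). 1 \<le> x \<and> real x \<le> H \<and> 1 \<le> y \<and> real y \<le> H}.
            real_of_int ((moebius (x\<^sup>2 + y\<^sup>2 + 1))\<^sup>2))"

lemma finite_sqfree_sum_range:
  "finite {(x :: nat, y :: nat). 1 \<le> x \<and> real x \<le> H \<and> 1 \<le> y \<and> real y \<le> H}"
  by (rule finite_subset[of _ "{..nat \<lfloor>H\<rfloor>} \<times> {..nat \<lfloor>H\<rfloor>}"])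
     (auto simp: le_nat_floor)

definition num_roots :: "nat \<Rightarrow> nat" where
  "num_roots q = card {(x :: int, y :: int).
     1 \<le> x \<and> x \<le> int q \<and> 1 \<le> y \<and> y \<le> int q \<and> [x\<^sup>2 + y\<^sup>2 + 1 = 0] (mod int q)}"

text \<open>
  A product over the primes is rendered as a product over all naturals, in increasing order, whose
  factors at non-primes are 1.
\<close>

definition local_factor :: "nat \<Rightarrow> real" where
  "local_factor n = (if prime n then 1 - real (num_roots (n\<^sup>2)) / real n ^ 4 else 1)"

text \<open>
  The library's infinite product is a definite description, hence meaningful only when
  \<^term>\<open>local_factor\<close> is a convergent product.
\<close>

definition density_const :: real where
  "density_const = (\<Prod>n. local_factor n)"

end

theory Submission
  imports Defs "HOL-Number_Theory.Number_Theory" "HOL-Analysis.Analysis"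
begin

text \<open>
  Write \<open>\<mu>\<^sup>2(n)\<close> as the sum of \<open>\<mu>(d)\<close> over \<open>d\<^sup>2 dvd n\<close>, and cut the sum over \<open>d\<close> at \<open>H powr (2/3)\<close>.

  For large \<open>d\<close>, fix \<open>d\<close> and the cofactor \<open>k\<close> in \<open>x\<^sup>2 + y\<^sup>2 + 1 = k d\<^sup>2\<close>: the number of representations of
  \<open>k d\<^sup>2 - 1\<close> as a sum of two squares is at most the square of its number of divisors, which gives
  \<open>H powr (2 + \<epsilon>) / d\<^sup>2\<close> pairs for each \<open>d\<close>.

  For small \<open>d\<close> no exponential sums are needed. The pairs above a fixed root \<open>(x, y)\<close> modulo \<open>d\<close> form a
  coset of a lattice given by one linear congruence modulo \<open>d\<close>. Slicing it along a nonzero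
  vector \<open>(u, v)\<close> of the lattice with entries at most \<open>\<surd>d\<close> (pigeonhole) gives the expected count
  \<open>H\<^sup>2 / d\<^sup>3\<close> up to \<open>O(H / (d max(|u|, |v|)) + 1)\<close>. A given \<open>(u, v)\<close> serves at
  most \<open>d powr \<epsilon> gcd(d, u, v)\<close> roots, so summing over the roots costs \<open>d powr \<epsilon> (H / \<surd>d + d)\<close>, and summing
  over \<open>d\<close> up to the cut gives \<open>H powr (4/3 + \<epsilon>)\<close> again.
\<close>


subsection \<open>Divisors and squarefree numbers\<close>

text \<open>Why the exponent \<open>2/3\<close>: with the cut at \<open>y\<close>, small
  \<open>d\<close> cost the sum of \<open>H / sqrt d + d\<close>, about
  \<open>H sqrt y + y^2\<close>, and large \<open>d\<close> cost \<open>H^2 / y\<close>; all three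
  equal \<open>H powr (4/3)\<close> at \<open>y = H powr (2/3)\<close>. The linear congruence comes
  from writing a point above a root \<open>(x, y)\<close> modulo \<open>d\<close> as
  \<open>(x + d i, y + d j)\<close>: divisibility by \<open>d^2\<close> then constrains only
  \<open>2 x i + 2 y j\<close> modulo \<open>d\<close>. The obstacle is a skewed lattice: one root
  may miss its expected count by about \<open>H / d\<close>, and with about \<open>d\<close> roots
  the worst case would be an error of order \<open>H\<close> for every single \<open>d\<close>.
  Skewness is rare on average because a short vector \<open>(u, v)\<close> of the lattice above
  \<open>(x, y)\<close> is also an equation for the root: \<open>(x, y)\<close> lies on the line
  \<open>u x + v y = 0\<close> modulo \<open>d\<close>, and this line meets the curve
  \<open>x^2 + y^2 + 1 = 0\<close> in at most two points modulo every prime that does not divide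
  both \<open>u\<close> and \<open>v\<close>. Even \<open>d\<close> never occur, since
  \<open>x^2 + y^2 + 1\<close> is never divisible by 4; this keeps 2 invertible modulo
  \<open>d\<close>.\<close>

definition tau :: "nat \<Rightarrow> nat" where "tau n = card {d. d dvd n}"

lemma tau_prime_power_mult:
  assumes "prime p" "m > 0"
  shows "tau (p ^ a * m) \<le> (a + 1) * tau m"
proof -
  have "{d. d dvd p ^ a * m} \<subseteq> (\<lambda>(i, e). p ^ i * e) ` ({..a} \<times> {e. e dvd m})"
  proof
    fix d assume "d \<in> {d. d dvd p ^ a * m}"
    then obtain b c where bc: "d = b * c" "b dvd p ^ a" "c dvd m"
      using division_decomp[of d "p ^ a" m] by auto
    then obtain i where "i \<le> a" "b = p ^ i"
      using divides_primepow_nat[OF assms(1)] by blast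
    with bc show "d \<in> (\<lambda>(i, e). p ^ i * e) ` ({..a} \<times> {e. e dvd m})" by auto
  qed
  then have "tau (p ^ a * m) \<le> card ((\<lambda>(i, e). p ^ i * e) ` ({..a} \<times> {e. e dvd m}))"
    unfolding tau_def using assms(2) by (intro card_mono) auto
  also have "\<dots> \<le> card ({..a} \<times> {e. e dvd m})"
    using assms(2) by (intro card_image_le) auto
  finally show ?thesis by (simp add: tau_def card_cartesian_product)
qed

text \<open>The comparison is made prime by prime. If \<open>p\<close> is at least
  \<open>2 powr (1 / \<epsilon>)\<close>, then \<open>p powr \<epsilon>\<close> is at least 2 and
  the factor \<open>a + 1\<close> is absorbed outright. Each of the fewer than \<open>B\<close>
  smaller primes costs a factor \<open>K\<close>, so \<open>K ^ B\<close> serves as the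
  constant.\<close>

lemma tau_le_powr:
  assumes "\<epsilon> > 0"
  obtains C where "C \<ge> 1" "\<And>n. n > 0 \<Longrightarrow> real (tau n) \<le> C * real n powr \<epsilon>"
proof -
  define B where "B = nat \<lceil>2 powr (1 / \<epsilon>)\<rceil>"
  \<comment> \<open>Chosen so that \<open>a + 1\<close> is at most
    \<open>K * (1 + a * \<epsilon> * ln 2)\<close>, which the exponential inequality turns into
    \<open>K * 2 powr (a * \<epsilon>)\<close>.\<close>
  define K where "K = 1 + 1 / (\<epsilon> * ln 2)"
  have K: "K \<ge> 1" using assms by (simp add: K_def)
  have Kbound: "real a + 1 \<le> K * real p powr (real a * \<epsilon>)" if "p \<ge> 2" for a p :: nat
  proof -
    have "real a + 1 \<le> K * (1 + real a * \<epsilon> * ln 2)"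
      using assms by (simp add: K_def field_simps)
    also have "\<dots> \<le> K * exp (real a * \<epsilon> * ln 2)"
      using K exp_ge_add_one_self[of "real a * \<epsilon> * ln 2"] by (intro mult_left_mono) auto
    also have "\<dots> = K * 2 powr (real a * \<epsilon>)" by (simp add: powr_def)
    also have "\<dots> \<le> K * real p powr (real a * \<epsilon>)"
      using K assms that by (intro mult_left_mono powr_mono2) auto
    finally show ?thesis .
  qed
  have large: "real a + 1 \<le> real p powr (real a * \<epsilon>)" if "p \<ge> B" for a p :: nat
  proof -
    have "2 powr (1 / \<epsilon>) \<le> real p" using that by (simp add: B_def nat_le_iff ceiling_le_iff)
    then have "(2 powr (1 / \<epsilon>)) powr (real a * \<epsilon>) \<le> real p powr (real a * \<epsilon>)"
      using assms by (intro powr_mono2) auto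
    moreover have "(2 powr (1 / \<epsilon>)) powr (real a * \<epsilon>) = 2 ^ a"
      using assms by (simp add: powr_powr powr_realpow)
    moreover have "real (Suc a) \<le> real (2 ^ a)"
      unfolding of_nat_le_iff by (rule Suc_leI) (rule less_exp)
    ultimately show ?thesis by simp
  qed
  have main: "real (tau n) \<le> K ^ card {p \<in> prime_factors n. p < B} * real n powr \<epsilon>" if "n > 0" for n
    using that
  proof (induction n rule: less_induct)
    case (less n)
    show ?case
    proof (cases "n = 1")
      case True
      then show ?thesis by (simp add: tau_def)
    next
      case False
      then obtain p where p: "prime p" "p dvd n" using prime_factor_nat by blast
      define a where "a = multiplicity p n"
      obtain m where m: "n = p ^ a * m" "\<not> p dvd m"
        using multiplicity_decompose'[of n p] less.prems p a_def by (metis not_prime_unit gr_implies_not0)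
      have a: "a > 0" using p less.prems by (simp add: a_def prime_multiplicity_gt_zero_iff)
      have m0: "m > 0" using m less.prems by (cases m) auto
      have "p ^ a > 1" using a prime_gt_1_nat[OF p(1)] by (intro one_less_power) auto
      then have "m < n" using m m0 by simp
      then have IH: "real (tau m) \<le> K ^ card {p \<in> prime_factors m. p < B} * real m powr \<epsilon>"
        using less.IH m0 by blast
      have pf: "prime_factors n = insert p (prime_factors m)"
        using m m0 p a by (simp add: prime_factors_product prime_factors_power prime_prime_factors)
      have pnot: "p \<notin> prime_factors m" using m by auto
      have step: "real (a + 1) * K ^ card {q \<in> prime_factors m. q < B} \<le>
          K ^ card {q \<in> prime_factors n. q < B} * real p powr (real a * \<epsilon>)"
      proof (cases "p < B")
        case True
        then have "{q \<in> prime_factors n. q < B} = insert p {q \<in> prime_factors m. q < B}"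
          using pf by auto
        then have "card {q \<in> prime_factors n. q < B} = Suc (card {q \<in> prime_factors m. q < B})"
          using pnot by simp
        then show ?thesis
          using Kbound[of p a] prime_ge_2_nat[OF p(1)] K by (simp add: mult.commute mult.left_commute mult_left_mono)
      next
        case False
        then have "{q \<in> prime_factors n. q < B} = {q \<in> prime_factors m. q < B}" using pf by auto
        then show ?thesis using large[of p a] False K by (simp add: mult.commute mult_left_mono)
      qed
      have "real (tau n) \<le> real (a + 1) * real (tau m)"
        unfolding m(1) of_nat_mult[symmetric] of_nat_le_iff by (rule tau_prime_power_mult[OF p(1) m0])
      also have "\<dots> \<le> real (a + 1) * (K ^ card {p \<in> prime_factors m. p < B} * real m powr \<epsilon>)"
        using IH by (intro mult_left_mono) auto
      also have "\<dots> \<le> K ^ card {q \<in> prime_factors n. q < B} * real p powr (real a * \<epsilon>) * real m powr \<epsilon>"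
        using step by (simp add: mult.assoc[symmetric] mult_right_mono)
      also have "real p powr (real a * \<epsilon>) = real (p ^ a) powr \<epsilon>"
        using p by (simp add: powr_powr[symmetric] powr_realpow prime_gt_0_nat)
      finally show ?thesis by (simp add: m(1) powr_mult mult.assoc)
    qed
  qed
  show ?thesis
  proof
    show "K ^ B \<ge> 1" using K by simp
    fix n :: nat assume n: "n > 0"
    have "card {p \<in> prime_factors n. p < B} \<le> card {..<B}" by (intro card_mono) auto
    then have "K ^ card {p \<in> prime_factors n. p < B} \<le> K ^ B" using K by (intro power_increasing) auto
    then show "real (tau n) \<le> K ^ B * real n powr \<epsilon>"
      using main[OF n] by (meson dual_order.trans mult_right_mono powr_ge_zero)
  qed
qed

section \<open>Squarefree numbers as finite sets of primes, and sums of the Moebius function\<close>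

lemma prime_factors_Prod:
  assumes "finite B" "\<And>p. p \<in> B \<Longrightarrow> prime (p :: nat)"
  shows "prime_factors (\<Prod>B) = B"
  using assms
proof (induction B rule: finite_induct)
  case (insert p B)
  then have "0 \<notin> B" by (metis insertCI not_prime_0)
  then have "prime_factors (p * \<Prod>B) = prime_factors p \<union> prime_factors (\<Prod>B)"
    using insert by (intro prime_factors_product) (auto simp: prod_zero_iff prime_gt_0_nat)
  with insert show ?case by (simp add: prime_prime_factors)
qed auto

lemma squarefree_Prod:
  assumes "\<And>p. p \<in> B \<Longrightarrow> prime (p :: nat)"
  shows "squarefree (\<Prod>B)"
  using assms by (intro squarefree_prod_coprime) (auto intro: primes_coprime squarefree_prime)

lemma Prod_prime_factors_squarefree:
  assumes "squarefree (n :: nat)"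
  shows "\<Prod>(prime_factors n) = n"
proof -
  have n: "n > 0" using assms by (cases n) auto
  have "(\<Prod>p\<in>prime_factors n. p ^ multiplicity p n) = n"
    using n by (simp add: prime_factorization_nat[symmetric])
  moreover have "multiplicity p n = 1" if "p \<in> prime_factors n" for p
  proof -
    have "multiplicity p n \<le> 1" "multiplicity p n > 0"
      using assms n that squarefree_factorial_semiring''[of n] by (auto simp: prime_factors_multiplicity)
    then show ?thesis by simp
  qed
  ultimately show ?thesis by simp
qed

lemma bij_betw_Prod_squarefree:
  assumes "finite A" "\<And>p. p \<in> A \<Longrightarrow> prime (p :: nat)"
  shows "bij_betw (\<lambda>B. \<Prod>B) (Pow A) {d. squarefree d \<and> prime_factors d \<subseteq> A}"
proof (rule bij_betwI[where g = prime_factors])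
  show "(\<lambda>B. \<Prod>B) \<in> Pow A \<rightarrow> {d. squarefree d \<and> prime_factors d \<subseteq> A}"
    using assms by (auto intro!: squarefree_Prod) (metis finite_subset prime_factors_Prod subset_eq)
  show "prime_factors (\<Prod>B) = B" if "B \<in> Pow A" for B
    using assms that by (intro prime_factors_Prod) (auto intro: finite_subset)
qed (auto simp: Prod_prime_factors_squarefree)

lemma moebius_Prod:
  assumes "finite B" "\<And>p. p \<in> B \<Longrightarrow> prime (p :: nat)"
  shows "moebius (\<Prod>B) = (-1) ^ card B"
  using assms by (simp add: moebius_def squarefree_Prod prime_factors_Prod)

lemma squarefree_dvd_iff:
  assumes "squarefree d" "n > (0 :: nat)"
  shows "d dvd n \<longleftrightarrow> prime_factors d \<subseteq> prime_factors n"
proof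
  assume "prime_factors d \<subseteq> prime_factors n"
  then have "\<Prod>(prime_factors d) dvd \<Prod>(prime_factors n)" by (intro prod_dvd_prod_subset) auto
  also have "\<Prod>(prime_factors n) dvd (\<Prod>p\<in>prime_factors n. p ^ multiplicity p n)"
    using assms(2) by (intro prod_dvd_prod dvd_power) (auto simp: prime_factors_multiplicity)
  also have "(\<Prod>p\<in>prime_factors n. p ^ multiplicity p n) = n"
    using assms(2) by (simp add: prime_factorization_nat[symmetric])
  finally show "d dvd n" using assms by (simp add: Prod_prime_factors_squarefree)
qed (use assms in \<open>simp add: dvd_prime_factors\<close>)

text \<open>Expand the product over subsets of \<open>A\<close> and read each subset as a squarefree
  \<open>d\<close>. With \<open>f\<close> constantly 1 this gives the divisor sum of
  \<open>moebius\<close>; with \<open>f = root_density\<close> it links the Euler product to the sum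
  over \<open>d\<close>.\<close>

lemma sum_moebius_mult_dvd:
  fixes f :: "nat \<Rightarrow> real"
  assumes "finite A" "\<And>p. p \<in> A \<Longrightarrow> prime (p :: nat)"
  shows "(\<Sum>d | squarefree d \<and> prime_factors d \<subseteq> A. moebius d * (\<Prod>p\<in>prime_factors d. f p)) =
    (\<Prod>p\<in>A. 1 - f p)"
proof -
  have "(\<Prod>p\<in>A. 1 - f p) = (\<Prod>p\<in>A. - f p + 1)" by simp
  also have "\<dots> = (\<Sum>B\<in>Pow A. (\<Prod>p\<in>B. - f p))"
    using assms(1) by (subst prod_add) auto
  also have "\<dots> = (\<Sum>B\<in>Pow A. moebius (\<Prod>B) * (\<Prod>p\<in>prime_factors (\<Prod>B). f p))"
  proof (rule sum.cong)
    fix B assume "B \<in> Pow A"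
    then have B: "finite B" "\<And>p. p \<in> B \<Longrightarrow> prime p" using assms by (auto intro: finite_subset)
    show "(\<Prod>p\<in>B. - f p) = moebius (\<Prod>B) * (\<Prod>p\<in>prime_factors (\<Prod>B). f p)"
      using B by (simp add: moebius_Prod prime_factors_Prod prod_uminus)
  qed auto
  also have "\<dots> = (\<Sum>d | squarefree d \<and> prime_factors d \<subseteq> A. moebius d * (\<Prod>p\<in>prime_factors d. f p))"
    by (rule sum.reindex_bij_betw[OF bij_betw_Prod_squarefree[OF assms]])
  finally show ?thesis by simp
qed

lemma sum_moebius_dvd:
  assumes "n > 0"
  shows "(\<Sum>d | d dvd n. real_of_int (moebius d)) = (if n = 1 then 1 else 0)"
proof -
  have "(\<Sum>d | d dvd n. real_of_int (moebius d)) =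
      (\<Sum>d | squarefree d \<and> prime_factors d \<subseteq> prime_factors n. real_of_int (moebius d))"
    using assms by (intro sum.mono_neutral_cong_right) (auto simp: moebius_def squarefree_dvd_iff)
  also have "\<dots> = (\<Prod>p\<in>prime_factors n. 1 - 1)"
    by (subst sum_moebius_mult_dvd[symmetric]) auto
  also have "\<dots> = (if n = 1 then 1 else 0)"
    using assms by (auto simp: card_gt_0_iff prime_factorization_empty_iff)
  finally show ?thesis .
qed

text \<open>The \<open>d\<close> with \<open>d^2\<close> dividing \<open>n\<close> are exactly the
  divisors of the largest square part of \<open>n\<close>, so the divisor sum of
  \<open>moebius\<close> detects whether that part is 1.\<close>

lemma moebius_square_sum:
  assumes "n > 0"
  shows "real_of_int ((moebius n)\<^sup>2) = (\<Sum>d | d\<^sup>2 dvd n. real_of_int (moebius d))"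
proof -
  have "square_part n = 1 \<longleftrightarrow> squarefree n"
  proof
    assume "square_part n = 1"
    then show "squarefree n" by (intro squarefreeI) (simp flip: dvd_square_part_iff)
  next
    assume "squarefree n"
    then show "square_part n = 1" using squarefreeD[of n "square_part n"] by simp
  qed
  moreover have "square_part n > 0" using assms square_part_0_iff[of n] by linarith
  moreover have "{d. d\<^sup>2 dvd n} = {d. d dvd square_part n}" by (auto simp: dvd_square_part_iff)
  ultimately show ?thesis by (simp add: sum_moebius_dvd moebius_square)
qed

lemma two_power_card_prime_factors_le_tau:
  assumes "squarefree n"
  shows "2 ^ card (prime_factors n) \<le> tau n"
proof -
  have n: "n > 0" using assms by (cases n) auto
  have "card (Pow (prime_factors n)) = card {d. squarefree d \<and> prime_factors d \<subseteq> prime_factors n}"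
    by (rule bij_betw_same_card[OF bij_betw_Prod_squarefree]) auto
  also have "\<dots> \<le> tau n"
    unfolding tau_def using n by (intro card_mono) (auto simp: squarefree_dvd_iff)
  finally show ?thesis by (simp add: card_Pow)
qed

subsection \<open>Representations by two squares\<close>

text \<open>By the two-squares identity \<open>(x x' + y y')^2 + D^2 = n^2\<close> with
  \<open>D = x y' - x' y\<close>. Positivity makes the first square nonzero, so \<open>D\<close> is
  smaller than \<open>n\<close> in absolute value and divisibility forces \<open>D = 0\<close>. The
  two pairs are then proportional, and coprimality makes them equal.\<close>

lemma pos_rep_eqI:
  fixes x y x' y' n :: int
  assumes pos: "x > 0" "y > 0" "x' > 0" "y' > 0"
    and reps: "x\<^sup>2 + y\<^sup>2 = n" "x'\<^sup>2 + y'\<^sup>2 = n"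
    and cop: "coprime x y" "coprime x' y'"
    and dvd: "n dvd x * y' - x' * y"
  shows "x = x' \<and> y = y'"
proof -
  define D where "D = x * y' - x' * y"
  have id: "(x * x' + y * y')\<^sup>2 + D\<^sup>2 = n\<^sup>2"
  proof -
    have "(x * x' + y * y')\<^sup>2 + D\<^sup>2 = (x\<^sup>2 + y\<^sup>2) * (x'\<^sup>2 + y'\<^sup>2)"
      by (simp add: D_def power2_eq_square algebra_simps)
    then show ?thesis using reps by (simp add: power2_eq_square)
  qed
  have "x * x' + y * y' > 0" using pos by (simp add: add_pos_pos)
  then have "D\<^sup>2 < n\<^sup>2" using id by (smt (verit) zero_less_power)
  then have "\<bar>D\<bar> < \<bar>n\<bar>" by (simp add: abs_square_less_1 power2_less_imp_less abs_le_square_iff linorder_not_le[symmetric])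
  then have "D = 0" using dvd dvd_imp_le_int[of D n] unfolding D_def by fastforce
  then have eq: "x * y' = x' * y" by (simp add: D_def)
  then have "x dvd x'" using cop(1) by (metis coprime_dvd_mult_left_iff dvd_triv_left)
  moreover have "x' dvd x" using cop(2) eq by (metis coprime_dvd_mult_left_iff dvd_triv_left)
  ultimately have "x = x'" using pos by (simp add: zdvd_antisym_nonneg)
  then show ?thesis using eq pos by simp
qed

lemma card_coprime_reps_le:
  assumes n: "n > 0"
  shows "card {(x :: int, y). x > 0 \<and> y > 0 \<and> coprime x y \<and> x\<^sup>2 + y\<^sup>2 = int n} \<le> tau n"
    (is "card ?R \<le> _")
proof (cases "?R = {}")
  case False
  then obtain x0 y0 where R0: "(x0, y0) \<in> ?R" by auto
  \<comment> \<open>A representation gives a square root \<open>x / y\<close> of \<open>-1\<close> modulo \<open>n\<close>; the gcd records at which primes it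
    agrees with \<open>x0 / y0\<close> rather than its negative.\<close>
  define G where "G = (\<lambda>(x, y). nat (gcd (x * y0 - x0 * y) (int n)))"
  have "inj_on G ?R"
  proof (rule inj_onI, clarify)
    fix x y x' y'
    assume *: "x > 0" "y > 0" "coprime x y" "x\<^sup>2 + y\<^sup>2 = int n"
      "x' > 0" "y' > 0" "coprime x' y'" "x'\<^sup>2 + y'\<^sup>2 = int n"
      and G: "G (x, y) = G (x', y')"
    define g where "g = gcd (x * y0 - x0 * y) (int n)"
    have g': "g = gcd (x' * y0 - x0 * y') (int n)" using G by (simp add: G_def g_def nat_eq_iff)
    have g0: "g > 0" using n by (simp add: g_def)
    have "g dvd int n" by (simp add: g_def)
    then obtain h where h: "int n = g * h" by (rule dvdE)
    have r0: "x0\<^sup>2 + y0\<^sup>2 = int n" "coprime x0 y0" using R0 by auto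
    \<comment> \<open>The product of the two factors is a multiple of \<open>n = g h\<close>. As
      \<open>g\<close> is the full gcd of the first factor with \<open>n\<close>, the quotient
      \<open>k\<close> of that factor by \<open>g\<close> is coprime to \<open>h\<close>, so
      \<open>h\<close> must divide the other factor.\<close>
    have plus: "h dvd u * y0 + x0 * v" if uv: "u\<^sup>2 + v\<^sup>2 = int n" and gg: "g = gcd (u * y0 - x0 * v) (int n)" for u v
    proof -
      have "(u * y0 - x0 * v) * (u * y0 + x0 * v) = int n * (u\<^sup>2 - x0\<^sup>2)"
      proof -
        have "y0\<^sup>2 = int n - x0\<^sup>2" "v\<^sup>2 = int n - u\<^sup>2" using uv r0(1) by linarith+
        moreover have "(u * y0 - x0 * v) * (u * y0 + x0 * v) = u\<^sup>2 * y0\<^sup>2 - x0\<^sup>2 * v\<^sup>2"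
          by (simp add: power2_eq_square algebra_simps)
        ultimately show ?thesis by (simp only:) (simp add: algebra_simps)
      qed
      then have d: "g * h dvd (u * y0 - x0 * v) * (u * y0 + x0 * v)" by (simp flip: h)
      have "g dvd u * y0 - x0 * v" unfolding gg by (rule gcd_dvd1)
      then obtain k where k: "u * y0 - x0 * v = g * k" by (rule dvdE)
      have "gcd k h = 1"
      proof -
        have "g = gcd (g * k) (g * h)" using gg by (simp only: k h)
        also have "\<dots> = \<bar>g\<bar> * gcd k h" by (rule gcd_mult_distrib_int[symmetric])
        finally show ?thesis using g0 by simp
      qed
      then have "coprime h k" unfolding coprime_iff_gcd_eq_1 by (simp only: gcd.commute)
      moreover have "h dvd k * (u * y0 + x0 * v)" using d k g0 by (simp add: mult.assoc)
      ultimately show ?thesis by (simp add: coprime_dvd_mult_right_iff)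
    qed
    have cn: "coprime u (int n) \<and> coprime v (int n)" if "coprime u v" "u\<^sup>2 + v\<^sup>2 = int n" for u v
    proof -
      have c: "coprime u (u * u + v * v)" "coprime v (v * v + u * u)"
        using that(1) gcd_add_mult[of u u "v * v"] gcd_add_mult[of v v "u * u"]
        by (simp_all add: coprime_iff_gcd_eq_1[symmetric] coprime_commute[of v])
      have "u * u + v * v = int n" "v * v + u * u = int n"
        using that(2) by (simp_all add: power2_eq_square)
      with c show ?thesis by (simp only:)
    qed
    \<comment> \<open>A common prime would divide the sum \<open>2 x y0\<close> of the two factors,
      while \<open>x\<close> and \<open>y0\<close> are coprime to \<open>n\<close>; so it is 2. But
      then 4 divides \<open>x^2 + y^2\<close> with \<open>x\<close> and \<open>y\<close> both odd,
      which is impossible.\<close>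
    have cop: "coprime g h"
    proof (rule ccontr)
      assume "\<not> coprime g h"
      then have "\<bar>gcd g h\<bar> \<noteq> 1" unfolding coprime_iff_gcd_eq_1 by simp
      then obtain q where "prime q" "q dvd gcd g h" using prime_factor_int by blast
      then have q: "prime q" "q dvd g" "q dvd h" by auto
      have qn: "q dvd int n" unfolding h using q by (intro dvd_mult2)
      have "q dvd (x * y0 - x0 * y) + (x * y0 + x0 * y)"
      proof (rule dvd_add)
        have "g dvd x * y0 - x0 * y" unfolding g_def by (rule gcd_dvd1)
        with q(2) show "q dvd x * y0 - x0 * y" by (rule dvd_trans)
        from q(3) plus[OF *(4) g_def] show "q dvd x * y0 + x0 * y" by (rule dvd_trans)
      qed
      then have "q dvd 2 * (x * y0)" by (simp add: algebra_simps)
      moreover have "\<not> q dvd x" "\<not> q dvd y0"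
      proof -
        have "coprime x (int n)" "coprime y0 (int n)" using cn[OF *(3,4)] cn[OF r0(2,1)] by simp_all
        moreover have "\<not> is_unit q" using q(1) by (meson not_prime_unit)
        ultimately show "\<not> q dvd x" "\<not> q dvd y0"
          using coprime_common_divisor[of x "int n" q] coprime_common_divisor[of y0 "int n" q] qn by blast+
      qed
      ultimately have "q dvd 2" using q(1) by (simp add: prime_dvd_mult_iff)
      then have q2: "q = 2" using primes_dvd_imp_eq[OF q(1), of 2] by simp
      then have 4: "4 dvd x\<^sup>2 + y\<^sup>2" unfolding *(4) h using mult_dvd_mono[OF q(2,3)] by simp
      have "odd x \<or> odd y" using \<open>coprime x y\<close> using coprime_common_divisor[of x y 2] by auto
      moreover have "even (x\<^sup>2 + y\<^sup>2)" by (rule dvd_trans[OF _ 4]) simp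
      ultimately have "odd x" "odd y" by (simp_all add: even_power)
      then obtain i j where "x = 2 * i + 1" "y = 2 * j + 1" using oddE by metis
      then have "x\<^sup>2 + y\<^sup>2 = 4 * (i\<^sup>2 + i + j\<^sup>2 + j) + 2" by (simp add: power2_eq_square algebra_simps)
      then show False using 4 by presburger
    qed
    have y0n: "coprime y0 (int n)" using cn[OF r0(2,1)] by blast
    \<comment> \<open>Eliminating \<open>x0\<close>: modulo \<open>g\<close> both
      \<open>x / y\<close> and \<open>x' / y'\<close> equal \<open>x0 / y0\<close>, and modulo
      \<open>h\<close> both equal its negative. Hence they agree modulo both coprime factors, that
      is, modulo \<open>n\<close>.\<close>
    have "g dvd (x * y0 - x0 * y) * y' - (x' * y0 - x0 * y') * y"
    proof (rule dvd_diff; rule dvd_mult2)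
      show "g dvd x * y0 - x0 * y" unfolding g_def by (rule gcd_dvd1)
      show "g dvd x' * y0 - x0 * y'" unfolding g' by (rule gcd_dvd1)
    qed
    then have "g dvd y0 * (x * y' - x' * y)" by (simp add: algebra_simps)
    moreover have "coprime g y0" using y0n unfolding h by (simp add: coprime_commute)
    ultimately have "g dvd x * y' - x' * y" by (simp add: coprime_dvd_mult_right_iff)
    moreover have "h dvd (x * y0 + x0 * y) * y' - (x' * y0 + x0 * y') * y"
      using plus[OF *(4) g_def] plus[OF *(8) g'] by (intro dvd_diff dvd_mult2)
    then have "h dvd y0 * (x * y' - x' * y)" by (simp add: algebra_simps)
    moreover have "coprime h y0" using y0n unfolding h by (simp add: coprime_commute)
    ultimately have "h dvd x * y' - x' * y" "g dvd x * y' - x' * y" by (simp_all add: coprime_dvd_mult_right_iff)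
    with cop have "int n dvd x * y' - x' * y" by (simp add: h divides_mult)
    with * show "x = x' \<and> y = y'" by (intro pos_rep_eqI[of x y x' y' "int n"]) auto
  qed
  moreover have "G ` ?R \<subseteq> {d. d dvd n}"
    by (auto simp: G_def nat_dvd_iff)
  ultimately show ?thesis
    unfolding tau_def using n by (intro card_inj_on_le) auto
qed (simp only: card.empty)

text \<open>Dividing by \<open>g = gcd x y\<close> leaves a coprime representation of
  \<open>n div g^2\<close>. There are at most \<open>tau n\<close> choices of \<open>g\<close>, and
  at most \<open>tau n\<close> representations for each.\<close>

lemma card_reps_le:
  assumes n: "n > 0"
  shows "card {(x :: nat, y). x > 0 \<and> y > 0 \<and> x\<^sup>2 + y\<^sup>2 = n} \<le> (tau n)\<^sup>2"
    (is "card ?S \<le> _")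
proof -
  define R where "R m = {(x :: int, y). x > 0 \<and> y > 0 \<and> coprime x y \<and> x\<^sup>2 + y\<^sup>2 = int m}" for m
  have finR: "finite (R m)" for m
  proof (rule finite_subset)
    show "R m \<subseteq> {0..int m} \<times> {0..int m}"
    proof (clarsimp simp: R_def)
      fix x y :: int assume *: "x > 0" "y > 0" "x\<^sup>2 + y\<^sup>2 = int m"
      have "x \<le> x\<^sup>2" "y \<le> y\<^sup>2" using * by (simp_all add: power2_eq_square)
      then show "x \<le> int m \<and> y \<le> int m" using * zero_le_power2[of x] zero_le_power2[of y] by linarith
    qed
  qed simp
  have sq: "{g. g\<^sup>2 dvd n} \<subseteq> {d. d dvd n}"
  proof (intro Collect_mono impI)
    fix g assume "g\<^sup>2 dvd n"
    then show "g dvd n" unfolding power2_eq_square by (rule dvd_mult_left)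
  qed
  have fin: "finite {g. g\<^sup>2 dvd n}"
    using n by (intro finite_subset[OF sq]) simp
  have "?S \<subseteq> (\<Union>g\<in>{g. g\<^sup>2 dvd n}. (\<lambda>(x, y). (g * nat x, g * nat y)) ` R (n div g\<^sup>2))"
  proof clarify
    fix x y :: nat assume *: "x > 0" "y > 0" "n = x\<^sup>2 + y\<^sup>2"
    define g where "g = gcd x y"
    have g: "g > 0" using * by (simp add: g_def)
    obtain a b where ab: "x = a * g" "y = b * g" "coprime a b"
      using gcd_coprime_exists[of x y] g unfolding g_def by blast
    have n': "n = g\<^sup>2 * (a\<^sup>2 + b\<^sup>2)" unfolding *(3) ab(1,2) by (simp add: power2_eq_square algebra_simps)
    then have "n div g\<^sup>2 = a\<^sup>2 + b\<^sup>2" using g by simp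
    then have "(int a, int b) \<in> R (n div g\<^sup>2)" using * ab by (auto simp: R_def)
    moreover have "g\<^sup>2 dvd n" using n' by simp
    ultimately show "(x, y) \<in> (\<Union>g\<in>{g. g\<^sup>2 dvd x\<^sup>2 + y\<^sup>2}. (\<lambda>(x, y). (g * nat x, g * nat y)) ` R ((x\<^sup>2 + y\<^sup>2) div g\<^sup>2))"
      unfolding *(3) using ab by (intro UN_I[of g] image_eqI[of _ _ "(int a, int b)"]) (auto simp: mult.commute)
  qed
  then have "card ?S \<le> card (\<Union>g\<in>{g. g\<^sup>2 dvd n}. (\<lambda>(x, y). (g * nat x, g * nat y)) ` R (n div g\<^sup>2))"
    using n finR fin by (intro card_mono) auto
  also have "\<dots> \<le> (\<Sum>g | g\<^sup>2 dvd n. card ((\<lambda>(x, y). (g * nat x, g * nat y)) ` R (n div g\<^sup>2)))"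
    using fin by (intro card_UN_le) auto
  also have "\<dots> \<le> (\<Sum>g | g\<^sup>2 dvd n. tau n)"
  proof (rule sum_mono)
    fix g assume g: "g \<in> {g. g\<^sup>2 dvd n}"
    then have pos: "n div g\<^sup>2 > 0" using n by (auto elim!: dvdE)
    have "card ((\<lambda>(x, y). (g * nat x, g * nat y)) ` R (n div g\<^sup>2)) \<le> card (R (n div g\<^sup>2))"
      by (rule card_image_le[OF finR])
    also have "\<dots> \<le> tau (n div g\<^sup>2)" unfolding R_def by (rule card_coprime_reps_le[OF pos])
    also have "\<dots> \<le> tau n"
    proof -
      have "n div g\<^sup>2 dvd n" using g by (metis dvd_div_mult_self dvd_triv_left mem_Collect_eq)
      then have "{d. d dvd n div g\<^sup>2} \<subseteq> {d. d dvd n}" by (intro Collect_mono impI) (rule dvd_trans)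
      then show ?thesis unfolding tau_def using n by (intro card_mono) simp_all
    qed
    finally show "card ((\<lambda>(x, y). (g * nat x, g * nat y)) ` R (n div g\<^sup>2)) \<le> tau n" .
  qed
  also have "\<dots> = card {g. g\<^sup>2 dvd n} * tau n" by simp
  also have "\<dots> \<le> tau n * tau n"
    unfolding tau_def using n
    by (intro mult_right_mono card_mono sq) simp_all
  finally show ?thesis by (simp add: power2_eq_square)
qed

subsection \<open>Roots modulo an integer\<close>

text \<open>The choice \<open>u = v = 0\<close> gives all roots modulo \<open>n\<close>, so the same
  product formula and local bounds serve both the root counts themselves and the roots that share a
  lattice vector.\<close>

definition roots_on_line :: "int \<Rightarrow> int \<Rightarrow> nat \<Rightarrow> (int \<times> int) set" where
  "roots_on_line u v n = {(x, y). x \<in> {0..<int n} \<and> y \<in> {0..<int n} \<and>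
     int n dvd x\<^sup>2 + y\<^sup>2 + 1 \<and> int n dvd u * x + v * y}"

lemma finite_roots_on_line [simp, intro]: "finite (roots_on_line u v n)"
  by (rule finite_subset[of _ "{0..<int n} \<times> {0..<int n}"]) (auto simp: roots_on_line_def)

lemma sum_squares_dvd_mod_iff:
  fixes n x y :: int
  shows "n dvd (x mod n)\<^sup>2 + (y mod n)\<^sup>2 + 1 \<longleftrightarrow> n dvd x\<^sup>2 + y\<^sup>2 + 1"
  by (intro cong_dvd_iff cong_add cong_pow cong_refl) (simp_all add: cong_def)

lemma linear_dvd_mod_iff:
  fixes n x y u v :: int
  shows "n dvd u * (x mod n) + v * (y mod n) \<longleftrightarrow> n dvd u * x + v * y"
  by (intro cong_dvd_iff cong_add cong_mult cong_refl) (simp_all add: cong_def)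

lemma mod_mem_roots_on_line_iff:
  assumes "n > 0"
  shows "(x mod int n, y mod int n) \<in> roots_on_line u v n \<longleftrightarrow>
    int n dvd x\<^sup>2 + y\<^sup>2 + 1 \<and> int n dvd u * x + v * y"
  using assms by (simp add: roots_on_line_def sum_squares_dvd_mod_iff linear_dvd_mod_iff)

text \<open>Chinese remainder theorem in each coordinate; both conditions are polynomial congruences
  and hence split along the two coprime factors.\<close>

lemma card_roots_on_line_mult:
  assumes "coprime m n" "m > 0" "n > 0"
  shows "card (roots_on_line u v (m * n)) = card (roots_on_line u v m) * card (roots_on_line u v n)"
proof -
  have cop: "coprime (int m) (int n)" using assms by simp
  have dvd_iff: "int (m * n) dvd z \<longleftrightarrow> int m dvd z \<and> int n dvd z" for z
    using cop by (auto intro: divides_mult dest: dvd_mult_left dvd_mult_right)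
  have "bij_betw (\<lambda>(x, y). ((x mod int m, y mod int m), (x mod int n, y mod int n)))
    (roots_on_line u v (m * n)) (roots_on_line u v m \<times> roots_on_line u v n)"
    unfolding bij_betw_def
  proof
    show "inj_on (\<lambda>(x, y). ((x mod int m, y mod int m), (x mod int n, y mod int n))) (roots_on_line u v (m * n))"
    proof (rule inj_onI, clarsimp)
      fix x y x' y'
      assume mem: "(x, y) \<in> roots_on_line u v (m * n)" "(x', y') \<in> roots_on_line u v (m * n)"
        and eqs: "x mod int m = x' mod int m" "y mod int m = y' mod int m"
          "x mod int n = x' mod int n" "y mod int n = y' mod int n"
      have eq: "z = z'" if "z \<in> {0..<int (m * n)}" "z' \<in> {0..<int (m * n)}"
        "z mod int m = z' mod int m" "z mod int n = z' mod int n" for z z'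
      proof -
        have "int (m * n) dvd z - z'" using that by (simp only: dvd_iff mod_eq_dvd_iff)
        then have "z mod int (m * n) = z' mod int (m * n)" by (simp only: mod_eq_dvd_iff)
        then show ?thesis using that by simp
      qed
      show "x = x' \<and> y = y'" using mem eqs eq[of x x'] eq[of y y'] by (simp add: roots_on_line_def)
    qed
    show "(\<lambda>(x, y). ((x mod int m, y mod int m), (x mod int n, y mod int n))) ` roots_on_line u v (m * n) =
      roots_on_line u v m \<times> roots_on_line u v n"
    proof (rule equalityI; clarsimp)
      fix x y assume "(x, y) \<in> roots_on_line u v (m * n)"
      then have "int (m * n) dvd x\<^sup>2 + y\<^sup>2 + 1" "int (m * n) dvd u * x + v * y"
        by (auto simp: roots_on_line_def)
      then show "(x mod int m, y mod int m) \<in> roots_on_line u v m \<and> (x mod int n, y mod int n) \<in> roots_on_line u v n"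
        using assms unfolding dvd_iff by (simp add: mod_mem_roots_on_line_iff)
    next
      fix x y x' y'
      assume mem: "(x, y) \<in> roots_on_line u v m" "(x', y') \<in> roots_on_line u v n"
      have crt: "\<exists>t. t mod int m = z \<and> t mod int n = z'" if "z \<in> {0..<int m}" "z' \<in> {0..<int n}" for z z'
      proof -
        obtain t where "[t = z] (mod int m)" "[t = z'] (mod int n)"
          using binary_chinese_remainder_int[OF cop] by blast
        then have "t mod int m = z mod int m" "t mod int n = z' mod int n" 
          unfolding unique_euclidean_semiring_class.cong_def by simp_all
        with that have "t mod int m = z \<and> t mod int n = z'" by simp
        then show ?thesis ..
      qed
      obtain s where s: "s mod int m = x" "s mod int n = x'" using crt mem by (auto simp: roots_on_line_def)
      obtain t where t: "t mod int m = y" "t mod int n = y'" using crt mem by (auto simp: roots_on_line_def)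
      have "(s mod int (m * n), t mod int (m * n)) \<in> roots_on_line u v (m * n)"
        using mem s t assms mod_mem_roots_on_line_iff[of m s t u v] mod_mem_roots_on_line_iff[of n s t u v]
          mod_mem_roots_on_line_iff[of "m * n" s t u v] dvd_iff by simp
      moreover have "s mod int (m * n) mod int m = x" "s mod int (m * n) mod int n = x'"
        "t mod int (m * n) mod int m = y" "t mod int (m * n) mod int n = y'"
        using s t by (simp_all add: mod_mod_cancel)
      ultimately show "((x, y), x', y') \<in> (\<lambda>(x, y). ((x mod int m, y mod int m), x mod int n, y mod int n)) `
          roots_on_line u v (m * n)"
        by (intro image_eqI[of _ _ "(s mod int (m * n), t mod int (m * n))"]) auto
    qed
  qed
  then show ?thesis by (simp add: bij_betw_same_card card_cartesian_product)
qed

lemma card_roots_on_line_1: "card (roots_on_line u v 1) = 1"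
proof -
  have "roots_on_line u v 1 = {(0, 0)}" by (auto simp: roots_on_line_def)
  then show ?thesis by simp
qed

text \<open>Used with \<open>k = 1\<close> for roots modulo a squarefree \<open>d\<close> and with
  \<open>k = 2\<close> for roots modulo \<open>d^2\<close>.\<close>

lemma card_roots_on_line_Prod:
  assumes "finite A" "\<And>p. p \<in> A \<Longrightarrow> prime p"
  shows "card (roots_on_line u v ((\<Prod>A) ^ k)) = (\<Prod>p\<in>A. card (roots_on_line u v (p ^ k)))"
  using assms
proof (induction A rule: finite_induct)
  case (insert p A)
  have "coprime p (\<Prod>A)" using insert by (intro prod_coprime_right) (auto intro: primes_coprime)
  moreover have "\<Prod>A > 0" using insert by (intro prod_pos) (auto simp: prime_gt_0_nat)
  ultimately show ?case
    using insert card_roots_on_line_mult[of "p ^ k" "(\<Prod>A) ^ k" u v]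
    by (simp add: power_mult_distrib prime_gt_0_nat)
qed (simp add: card_roots_on_line_1[simplified])

lemma card_square_roots_le:
  fixes S :: "int set" and p :: nat
  assumes "prime p" "S \<subseteq> {0..<int p}" "\<And>s t. s \<in> S \<Longrightarrow> t \<in> S \<Longrightarrow> int p dvd s\<^sup>2 - t\<^sup>2"
  shows "card S \<le> 2"
proof (cases "S = {}")
  case False
  then obtain s where s: "s \<in> S" by auto
  have "S \<subseteq> {s, (- s) mod int p}"
  proof
    fix t assume t: "t \<in> S"
    have "int p dvd (t - s) * (t + s)" using assms(3)[OF t s] by (simp add: power2_eq_square algebra_simps)
    then have "int p dvd t - s \<or> int p dvd t - (- s)" using assms(1) by (simp add: prime_dvd_mult_iff)
    then have "t mod int p = s mod int p \<or> t mod int p = (- s) mod int p" by (simp only: mod_eq_dvd_iff)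
    then show "t \<in> {s, (- s) mod int p}" using assms(2) s t by (auto simp: subset_iff)
  qed
  then have "card S \<le> card {s, (- s) mod int p}" by (intro card_mono) auto
  also have "\<dots> \<le> 2" by (simp add: card_insert_if)
  finally show ?thesis .
qed simp

lemma card_roots_on_line_commute: "card (roots_on_line u v n) = card (roots_on_line v u n)"
  by (rule bij_betw_same_card[of prod.swap], rule bij_betwI[where g = prod.swap])
     (auto simp: roots_on_line_def ac_simps)

text \<open>If \<open>p\<close> does not divide \<open>u\<close>, then \<open>y\<close> determines
  \<open>x\<close>, and substitution leaves \<open>y^2 (u^2 + v^2) + u^2 = 0\<close> modulo
  \<open>p\<close>. Here \<open>u^2 + v^2\<close> is nonzero, since otherwise \<open>p\<close> would
  divide \<open>u^2\<close>; so \<open>y^2\<close> is determined and \<open>y\<close> has at most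
  two values. If \<open>p\<close> divides both \<open>u\<close> and \<open>v\<close>, each of the
  \<open>p\<close> values of \<open>x\<close> has at most two partners, and the gcd supplies the
  factor \<open>p\<close>.\<close>

lemma card_roots_on_line_prime_le:
  assumes p: "prime p"
  shows "card (roots_on_line u v p) \<le> 2 * nat (gcd (int p) (gcd u v))"
proof -
  have coprime_case: "card (roots_on_line u v p) \<le> 2" if "\<not> int p dvd u" for u v
  proof -
    have elim: "int p dvd u * (x - x')" if "(x, y) \<in> roots_on_line u v p" "(x', y') \<in> roots_on_line u v p"
      "int p dvd y - y'" for x y x' y'
    proof -
      have "int p dvd (u * x + v * y) - (u * x' + v * y') - v * (y - y')"
        using that by (intro dvd_diff[OF dvd_diff] dvd_mult[OF that(3)]) (auto simp: roots_on_line_def)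
      then show ?thesis by (simp add: algebra_simps)
    qed
    have "inj_on snd (roots_on_line u v p)"
    proof (rule inj_onI, clarsimp)
      fix x x' y assume mem: "(x, y) \<in> roots_on_line u v p" "(x', y) \<in> roots_on_line u v p"
      then have "int p dvd x - x'" using elim[OF mem] p \<open>\<not> int p dvd u\<close> by (simp add: prime_dvd_mult_iff)
      then have "x mod int p = x' mod int p" by (simp only: mod_eq_dvd_iff)
      then show "x = x'" using mem by (simp add: roots_on_line_def)
    qed
    then have "card (roots_on_line u v p) = card (snd ` roots_on_line u v p)" by (simp add: card_image)
    also have "\<dots> \<le> 2"
    proof (rule card_square_roots_le[OF p])
      show "snd ` roots_on_line u v p \<subseteq> {0..<int p}" by (auto simp: roots_on_line_def)
      fix s t assume "s \<in> snd ` roots_on_line u v p" "t \<in> snd ` roots_on_line u v p"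
      then obtain x x' where mem: "(x, s) \<in> roots_on_line u v p" "(x', t) \<in> roots_on_line u v p" by auto
      have key: "int p dvd y\<^sup>2 * (u\<^sup>2 + v\<^sup>2) + u\<^sup>2" if "(x, y) \<in> roots_on_line u v p" for x y
      proof -
        \<comment> \<open>This combination cancels \<open>u^2 x^2\<close> and thereby eliminates
          \<open>x\<close>.\<close>
        have "int p dvd u\<^sup>2 * (x\<^sup>2 + y\<^sup>2 + 1) - (u * x + v * y) * (u * x - v * y)"
          using that by (intro dvd_diff[OF dvd_mult dvd_mult2]) (auto simp: roots_on_line_def)
        then show ?thesis by (simp add: power2_eq_square algebra_simps)
      qed
      have "\<not> int p dvd u\<^sup>2 + v\<^sup>2"
      proof
        assume "int p dvd u\<^sup>2 + v\<^sup>2"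
        then have "int p dvd (s\<^sup>2 * (u\<^sup>2 + v\<^sup>2) + u\<^sup>2) - s\<^sup>2 * (u\<^sup>2 + v\<^sup>2)"
          by (intro dvd_diff[OF key[OF mem(1)] dvd_mult])
        then have "int p dvd u\<^sup>2" by simp
        then show False using p \<open>\<not> int p dvd u\<close> by (simp add: prime_dvd_power_iff)
      qed
      moreover have "int p dvd (s\<^sup>2 * (u\<^sup>2 + v\<^sup>2) + u\<^sup>2) - (t\<^sup>2 * (u\<^sup>2 + v\<^sup>2) + u\<^sup>2)"
        by (rule dvd_diff[OF key[OF mem(1)] key[OF mem(2)]])
      then have "int p dvd (s\<^sup>2 - t\<^sup>2) * (u\<^sup>2 + v\<^sup>2)" by (simp add: left_diff_distrib)
      ultimately show "int p dvd s\<^sup>2 - t\<^sup>2" using p by (simp add: prime_dvd_mult_iff)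
    qed
    finally show ?thesis .
  qed
  show ?thesis
  proof (cases "int p dvd u \<and> int p dvd v")
    case True
    have "roots_on_line u v p \<subseteq> (SIGMA x:{0..<int p}. {y \<in> {0..<int p}. int p dvd x\<^sup>2 + y\<^sup>2 + 1})"
      by (auto simp: roots_on_line_def)
    then have "card (roots_on_line u v p) \<le> card (SIGMA x:{0..<int p}. {y \<in> {0..<int p}. int p dvd x\<^sup>2 + y\<^sup>2 + 1})"
      by (intro card_mono finite_SigmaI finite_subset[of "{y \<in> {0..<int p}. _ y}" "{0..<int p}"]) auto
    also have "\<dots> = (\<Sum>x\<in>{0..<int p}. card {y \<in> {0..<int p}. int p dvd x\<^sup>2 + y\<^sup>2 + 1})"
      by (intro card_SigmaI ballI finite_subset[of "{y \<in> {0..<int p}. _ y}" "{0..<int p}"]) auto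
    also have "\<dots> \<le> (\<Sum>x\<in>{0..<int p}. 2)"
    proof (intro sum_mono card_square_roots_le[OF p])
      fix x s t assume "s \<in> {y \<in> {0..<int p}. int p dvd x\<^sup>2 + y\<^sup>2 + 1}" "t \<in> {y \<in> {0..<int p}. int p dvd x\<^sup>2 + y\<^sup>2 + 1}"
      then have "int p dvd (x\<^sup>2 + s\<^sup>2 + 1) - (x\<^sup>2 + t\<^sup>2 + 1)" by (intro dvd_diff[of _ "x\<^sup>2 + s\<^sup>2 + 1"]) auto
      then show "int p dvd s\<^sup>2 - t\<^sup>2" by simp
    qed auto
    also have "\<dots> = 2 * p" by simp
    also have "gcd (int p) (gcd u v) = int p" using True by (simp add: gcd_proj1_iff)
    then have "2 * p = 2 * nat (gcd (int p) (gcd u v))" by simp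
    finally show ?thesis .
  next
    case False
    then have "card (roots_on_line u v p) \<le> 2"
      using coprime_case[of u v] coprime_case[of v u] card_roots_on_line_commute[of u v p] by auto
    moreover have "gcd (int p) (gcd u v) > 0" using prime_gt_0_nat[OF p] by simp
    ultimately show ?thesis by linarith
  qed
qed

text \<open>Multiply the bounds over the primes of \<open>d\<close>: the local gcds are pairwise
  coprime divisors of \<open>gcd d (gcd u v)\<close>, so their product is at most that gcd.\<close>

lemma card_roots_on_line_squarefree_le:
  assumes "squarefree d"
  shows "card (roots_on_line u v d) \<le> 2 ^ card (prime_factors d) * nat (gcd (int d) (gcd u v))"
proof -
  have nat_int_gcd: "nat (gcd (int a) (gcd u v)) = gcd a (nat (gcd u v))" for a
    by (metis gcd_int_int_eq gcd_ge_0_int int_nat_eq nat_int)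
  have "card (roots_on_line u v d) = (\<Prod>p\<in>prime_factors d. card (roots_on_line u v p))"
    using card_roots_on_line_Prod[of "prime_factors d" u v 1] Prod_prime_factors_squarefree[OF assms]
    by (simp add: in_prime_factors_imp_prime)
  also have "\<dots> \<le> (\<Prod>p\<in>prime_factors d. 2 * nat (gcd (int p) (gcd u v)))"
    by (intro prod_mono) (auto intro: card_roots_on_line_prime_le)
  also have "\<dots> = 2 ^ card (prime_factors d) * (\<Prod>p\<in>prime_factors d. gcd p (nat (gcd u v)))"
    by (simp add: prod.distrib nat_int_gcd)
  also have "\<dots> \<le> 2 ^ card (prime_factors d) * gcd d (nat (gcd u v))"
  proof (rule mult_left_mono)
    have "(\<Prod>p\<in>A. gcd p g) dvd gcd (\<Prod>A) g" if "finite A" "\<And>p. p \<in> A \<Longrightarrow> prime p" for A and g :: nat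
      using that
    proof (induction A rule: finite_induct)
      case (insert p A)
      have "coprime p (\<Prod>A)" using insert by (intro prod_coprime_right) (auto intro: primes_coprime)
      then have "coprime (gcd p g) (gcd (\<Prod>A) g)"
        by (rule coprime_divisors[rotated 2]) simp_all
      moreover have "gcd p g dvd gcd (p * \<Prod>A) g" "gcd (\<Prod>A) g dvd gcd (p * \<Prod>A) g"
        by (auto intro: gcd_dvd1 dvd_mult dvd_mult2)
      ultimately have "gcd p g * gcd (\<Prod>A) g dvd gcd (p * \<Prod>A) g" by (intro divides_mult)
      moreover have "gcd p g * (\<Prod>p\<in>A. gcd p g) dvd gcd p g * gcd (\<Prod>A) g"
        using insert by (intro mult_dvd_mono) auto
      ultimately have "gcd p g * (\<Prod>p\<in>A. gcd p g) dvd gcd (p * \<Prod>A) g" by (metis dvd_trans)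
      then show ?case by (simp only: prod.insert[OF insert.hyps(1,2)])
    qed auto
    from this[of "prime_factors d" "nat (gcd u v)"]
    have "(\<Prod>p\<in>prime_factors d. gcd p (nat (gcd u v))) dvd gcd d (nat (gcd u v))"
      using Prod_prime_factors_squarefree[OF assms] by (simp add: in_prime_factors_imp_prime)
    moreover have "gcd d (nat (gcd u v)) > 0" using assms by (cases "d = 0") auto
    ultimately show "(\<Prod>p\<in>prime_factors d. gcd p (nat (gcd u v))) \<le> gcd d (nat (gcd u v))"
      by (rule dvd_imp_le)
  qed simp
  also have "gcd d (nat (gcd u v)) = nat (gcd (int d) (gcd u v))" by (simp add: nat_int_gcd)
  finally show ?thesis .
qed

lemma num_roots_eq:
  assumes "q > 0"
  shows "num_roots q = card (roots_on_line 0 0 q)"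
  unfolding num_roots_def
proof (rule bij_betw_same_card)
  let ?f = "\<lambda>(x, y). (x mod int q, y mod int q)"
  let ?h = "\<lambda>z. if z = 0 then int q else z"
  let ?g = "\<lambda>(x, y). (?h x, ?h y)"
  have hmod: "?h z mod int q = z" if "0 \<le> z" "z < int q" for z using that by auto
  have modh: "?h (z mod int q) = z" if "1 \<le> z" "z \<le> int q" for z
    using that by (cases "z = int q") auto
  show "bij_betw ?f {(x, y). 1 \<le> x \<and> x \<le> int q \<and> 1 \<le> y \<and> y \<le> int q \<and> [x\<^sup>2 + y\<^sup>2 + 1 = 0] (mod int q)}
    (roots_on_line 0 0 q)"
  proof (rule bij_betwI[where g = ?g])
    show "?f \<in> {(x, y). 1 \<le> x \<and> x \<le> int q \<and> 1 \<le> y \<and> y \<le> int q \<and> [x\<^sup>2 + y\<^sup>2 + 1 = 0] (mod int q)} \<rightarrow> roots_on_line 0 0 q"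
      using assms by (auto simp: mod_mem_roots_on_line_iff cong_0_iff)
    show "?g \<in> roots_on_line 0 0 q \<rightarrow> {(x, y). 1 \<le> x \<and> x \<le> int q \<and> 1 \<le> y \<and> y \<le> int q \<and> [x\<^sup>2 + y\<^sup>2 + 1 = 0] (mod int q)}"
    proof clarify
      fix x y assume mem: "(x, y) \<in> roots_on_line 0 0 q"
      then have "(?h x mod int q, ?h y mod int q) \<in> roots_on_line 0 0 q"
        using hmod[of x] hmod[of y] by (simp only: roots_on_line_def) auto
      then have "int q dvd (?h x)\<^sup>2 + (?h y)\<^sup>2 + 1"
        unfolding mod_mem_roots_on_line_iff[OF assms] by blast
      moreover have "1 \<le> ?h x \<and> ?h x \<le> int q \<and> 1 \<le> ?h y \<and> ?h y \<le> int q"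
        using mem assms by (auto simp: roots_on_line_def)
      ultimately show "1 \<le> ?h x \<and> ?h x \<le> int q \<and> 1 \<le> ?h y \<and> ?h y \<le> int q \<and> [(?h x)\<^sup>2 + (?h y)\<^sup>2 + 1 = 0] (mod int q)"
        unfolding cong_0_iff by blast
    qed
  qed (use hmod modh in \<open>auto simp: roots_on_line_def split del: if_split\<close>)
qed

subsection \<open>Points of a congruence lattice in a box\<close>

lemma le_div_iff_mult_le_int: "q \<le> a div m \<longleftrightarrow> m * q \<le> (a :: int)" if "m > 0"
proof
  assume "q \<le> a div m"
  then have "m * q \<le> m * (a div m)" using that by (intro mult_left_mono) auto
  also have "\<dots> \<le> a" using that pos_mod_sign[of m a] mult_div_mod_eq[of m a] by linarith
  finally show "m * q \<le> a" .
next
  assume "m * q \<le> a"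
  then have "(m * q) div m \<le> a div m" using that by (intro zdiv_mono1)
  then show "q \<le> a div m" using that by simp
qed

lemma progression_interval_eq:
  assumes "m > (0 :: int)"
  shows "{k. lo \<le> r + m * k \<and> r + m * k \<le> hi} = {- ((r - lo) div m)..(hi - r) div m}"
proof -
  have "lo \<le> r + m * k \<longleftrightarrow> - ((r - lo) div m) \<le> k" for k
    using le_div_iff_mult_le_int[OF assms, of "- k" "r - lo"] by auto
  moreover have "r + m * k \<le> hi \<longleftrightarrow> k \<le> (hi - r) div m" for k
    using le_div_iff_mult_le_int[OF assms, of k "hi - r"] by auto
  ultimately show ?thesis by auto
qed

lemma card_progression_interval:
  fixes lo hi r m :: int
  assumes "m > (0 :: int)" "lo \<le> hi + 1"
  shows "\<bar>real (card {k. lo \<le> r + m * k \<and> r + m * k \<le> hi}) - (hi - lo + 1) / m\<bar> \<le> 1"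
proof -
  define p q where "p = (hi - r) div m" and "q = (r - lo) div m"
  have p: "m * p \<le> hi - r" "hi - r - (m - 1) \<le> m * p"
    using assms pos_mod_bound[of m "hi - r"] pos_mod_sign[of m "hi - r"] mult_div_mod_eq[of m "hi - r"]
    unfolding p_def by linarith+
  have q: "m * q \<le> r - lo" "r - lo - (m - 1) \<le> m * q"
    using assms pos_mod_bound[of m "r - lo"] pos_mod_sign[of m "r - lo"] mult_div_mod_eq[of m "r - lo"]
    unfolding q_def by linarith+
  have up: "m * (p + q + 1) \<le> (hi - lo + 1) + m" using p q by (simp add: algebra_simps)
  have low: "(hi - lo + 1) - m + 1 \<le> m * (p + q + 1)" using p q by (simp add: algebra_simps)
  have "m * (- 1) < m * (p + q + 1)" using low assms by linarith
  then have "- 1 < p + q + 1" using assms by (simp only: mult_less_cancel_left_pos)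
  then have "real (card {- q..p}) = real_of_int (p + q + 1)" by simp
  moreover have "real_of_int m * real_of_int (p + q + 1) \<le> real_of_int (hi - lo + 1) + real_of_int m"
    using up by (metis of_int_add of_int_le_iff of_int_mult)
  moreover have "real_of_int (hi - lo + 1) - real_of_int m \<le> real_of_int m * real_of_int (p + q + 1)"
    using low by (metis (no_types) of_int_diff of_int_le_iff of_int_mult add_increasing2 less_imp_le zero_less_one dual_order.trans le_add_same_cancel1)
  ultimately show ?thesis
    using assms(1) unfolding progression_interval_eq[OF assms(1)] p_def[symmetric] q_def[symmetric]
    by (simp add: abs_le_iff field_simps)
qed

lemma card_residue_class_interval:
  fixes lo hi r m :: int
  assumes "m > (0 :: int)" "lo \<le> hi + 1"
  shows "\<bar>real (card {x \<in> {lo..hi}. m dvd x - r}) - (hi - lo + 1) / m\<bar> \<le> 1"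
proof -
  have "{x \<in> {lo..hi}. m dvd x - r} = (\<lambda>k. r + m * k) ` {k. lo \<le> r + m * k \<and> r + m * k \<le> hi}"
    by (auto simp: dvd_def image_iff algebra_simps)
  moreover have "inj_on (\<lambda>k. r + m * k) {k. lo \<le> r + m * k \<and> r + m * k \<le> hi}"
    using assms by (auto intro!: inj_onI)
  ultimately have "card {x \<in> {lo..hi}. m dvd x - r} = card {k. lo \<le> r + m * k \<and> r + m * k \<le> hi}"
    by (simp add: card_image)
  then show ?thesis using card_progression_interval[OF assms, of r] by simp
qed

text \<open>Stated for a block of consecutive integers without named endpoints, because the slices
  of a box along a slanted line are cut out by inequalities and their endpoints are never
  computed.\<close>

lemma card_residue_class_convex:
  fixes S :: "int set" and r m :: int
  assumes "m > (0 :: int)" "finite S" "\<And>x y z. x \<in> S \<Longrightarrow> z \<in> S \<Longrightarrow> x \<le> y \<Longrightarrow> y \<le> z \<Longrightarrow> y \<in> S"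
  shows "\<bar>real (card {x \<in> S. m dvd x - r}) - card S / m\<bar> \<le> 1"
proof (cases "S = {}")
  case False
  have mem: "Min S \<in> S" "Max S \<in> S" using assms(2) False by simp_all
  have "S = {Min S..Max S}"
  proof
    show "S \<subseteq> {Min S..Max S}" using assms(2) by (auto intro: Min_le Max_ge)
    show "{Min S..Max S} \<subseteq> S" using assms(3)[OF mem] by auto
  qed
  then obtain lo hi where S: "S = {lo..hi}" by blast
  then have "lo \<le> hi" using False by simp
  then show ?thesis
    using card_residue_class_interval[OF assms(1), of lo hi r] unfolding S by simp
qed simp

text \<open>The lattice vector used here is \<open>(e u, e v)\<close>, the shortest multiple of \<open>(u, v)\<close> in the lattice.\<close>

lemma lattice_count_primitive:
  fixes a b c d u v x1 y1 :: int and X Y :: nat and K :: real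
  assumes d: "d > 0" and cop: "\<And>q. prime q \<Longrightarrow> q dvd a \<Longrightarrow> q dvd b \<Longrightarrow> \<not> q dvd d"
    and uv: "coprime u v" "u > 0" "\<bar>v\<bar> \<le> u"
    and h: "h = gcd d (a * u + b * v)" "d = h * e" and small: "(e * u)\<^sup>2 \<le> d"
    and K: "real X \<le> K" "real Y \<le> K"
  shows "\<bar>real (card {(x, y). x \<in> {x1..<x1 + X} \<and> y \<in> {y1..<y1 + Y} \<and> d dvd a * x + b * y - c}) -
    real X * real Y / d\<bar> \<le> 4 * K / (e * u) + 2"
proof -
  \<comment> \<open>Unimodular coordinates \<open>x = k u - t s\<close>, \<open>y = k v + t r\<close>: in them \<open>a x + b y = k A + t B\<close>, and on
    the line of parameter \<open>t\<close> the congruence fixes \<open>k\<close> modulo \<open>e\<close> or has no solution.\<close>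
  obtain r s where rs: "u * r + v * s = 1"
    using uv(1) bezout_int[of u v] by (auto simp: coprime_iff_gcd_eq_1 algebra_simps)
  define A where "A = a * u + b * v"
  define B where "B = b * r - a * s"
  have aAB: "a = r * A - v * B"
  proof -
    have "r * A - v * B = a * (u * r + v * s)" by (simp add: A_def B_def algebra_simps)
    then show ?thesis using rs by simp
  qed
  have bAB: "b = s * A + u * B"
  proof -
    have "s * A + u * B = b * (u * r + v * s)" by (simp add: A_def B_def algebra_simps)
    then show ?thesis using rs by simp
  qed
  have hpos: "h > 0" using h(1) d by simp
  have epos: "e > 0" using h(2) d hpos by (simp add: zero_less_mult_iff)
  define m where "m = e * u"
  have mpos: "m > 0" using epos uv by (simp add: m_def)
  obtain w where w: "A = h * w" using h(1) unfolding A_def[symmetric] by (metis dvdE gcd_dvd2)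
  have ew: "coprime e w"
  proof -
    have "h = gcd (h * e) (h * w)" unfolding h(2)[symmetric] w[symmetric] unfolding A_def by (rule h(1))
    also have "\<dots> = \<bar>h\<bar> * gcd e w" by (rule gcd_mult_distrib_int[symmetric])
    finally show ?thesis using hpos by (simp add: coprime_iff_gcd_eq_1)
  qed
  \<comment> \<open>A prime dividing \<open>h\<close> and \<open>B\<close> also divides
    \<open>A\<close>, hence \<open>a\<close> and \<open>b\<close>, which are combinations of
    \<open>A\<close> and \<open>B\<close>; it divides \<open>d\<close> as well, against
    \<open>cop\<close>.\<close>
  have hB: "coprime h B"
  proof (rule ccontr)
    assume "\<not> coprime h B"
    then have "\<bar>gcd h B\<bar> \<noteq> 1" unfolding coprime_iff_gcd_eq_1 by simp
    then obtain q where "prime q" "q dvd gcd h B" using prime_factor_int by blast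
    then have q: "prime q" "q dvd h" "q dvd B" by auto
    have "q dvd A" using q(2) unfolding w by (rule dvd_mult2)
    then have "q dvd a" "q dvd b" unfolding aAB bAB using q(3) by (auto intro: dvd_diff dvd_add)
    moreover have "q dvd d" using q(2) unfolding h(2) by (rule dvd_mult2)
    ultimately show False using cop q(1) by blast
  qed
  \<comment> \<open>Modulo \<open>h\<close> the term \<open>k A\<close> vanishes, so only lines with
    \<open>t B = c\<close> modulo \<open>h\<close> can carry solutions. As \<open>B\<close> is
    invertible modulo \<open>h\<close>, these \<open>t\<close> form the single class of
    \<open>t0\<close>.\<close>
  obtain t0 where t0: "h dvd t0 * B - c"
  proof -
    obtain t where "[B * t = 1] (mod h)" using cong_solve_coprime_int[of B h] hB by (auto simp: coprime_commute)
    then have "h dvd B * t - 1" by (simp only: cong_iff_dvd_diff)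
    then have "h dvd (B * t - 1) * c" by (rule dvd_mult2)
    then have "h dvd (c * t) * B - c" by (simp add: algebra_simps)
    then show ?thesis by (rule that)
  qed
  have tclass: "h dvd t * B - c \<longleftrightarrow> h dvd t - t0" for t
  proof -
    have "t * B - c = (t - t0) * B + (t0 * B - c)" by (simp add: algebra_simps)
    then have "h dvd t * B - c \<longleftrightarrow> h dvd (t - t0) * B" using t0 by (simp only: dvd_add_left_iff)
    also have "\<dots> \<longleftrightarrow> h dvd t - t0" using hB by (simp add: coprime_dvd_mult_left_iff)
    finally show ?thesis .
  qed
  \<comment> \<open>On such a line, dividing by \<open>h\<close> leaves a congruence modulo
    \<open>e\<close> whose coefficient \<open>w\<close> is invertible, so it is solvable.\<close>
  have "\<exists>k. d dvd k * A + t * B - c" if "h dvd t - t0" for t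
  proof -
    obtain z where z: "t * B - c = h * z" using \<open>h dvd t - t0\<close> dvdE[of h "t * B - c"] unfolding tclass[symmetric] by blast
    obtain k where "[w * k = - z] (mod e)"
    proof -
      obtain k where "[w * k = 1] (mod e)" using cong_solve_coprime_int[of w e] ew by (auto simp: coprime_commute)
      then have "[w * k * (- z) = 1 * (- z)] (mod e)" by (intro cong_mult cong_refl)
      then show ?thesis using that[of "k * (- z)"] by (simp add: mult.assoc)
    qed
    then have "e dvd w * k + z" by (simp add: cong_iff_dvd_diff)
    then have "h * e dvd h * (w * k + z)" by simp
    moreover have "h * (w * k + z) = k * A + t * B - c" using z by (simp add: w algebra_simps)
    ultimately show ?thesis unfolding h(2) by metis
  qed
  then obtain k where k: "\<And>t. h dvd t - t0 \<Longrightarrow> d dvd k t * A + t * B - c" by metis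
  define xt where "xt t = k t * u - t * s" for t
  define I where "I = {x1..<x1 + X}"
  define J where "J = {y1..<y1 + Y}"
  define S where "S t = {x \<in> I. u * y1 \<le> v * x + t \<and> v * x + t < u * (y1 + Y)}" for t
  define P where "P = {(x, y). x \<in> I \<and> y \<in> J \<and> d dvd a * x + b * y - c}"
  \<comment> \<open>Only these \<open>t\<close> can meet the box: \<open>t = u y - v x\<close>, and
    \<open>\<bar>v\<bar> \<le> u\<close> keeps \<open>v x\<close> within \<open>u X\<close> of
    \<open>v x1\<close>. The generous range is harmless, since the size of \<open>T\<close> enters
    only the error.\<close>
  define T where "T = {t \<in> {u * y1 - v * x1 - u * X .. u * y1 - v * x1 + u * X + u * Y}. h dvd t - t0}"
  have lin: "a * x + b * y = j * A + t * B" if "x = j * u - t * s" "y = j * v + t * r" for x y j t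
    unfolding A_def B_def that by (simp add: algebra_simps)
  have coords: "x = (r * x + s * y) * u - (u * y - v * x) * s" "y = (r * x + s * y) * v + (u * y - v * x) * r" for x y
  proof -
    have "(r * x + s * y) * u - (u * y - v * x) * s = x * (u * r + v * s)" by (simp add: algebra_simps)
    then show "x = (r * x + s * y) * u - (u * y - v * x) * s" using rs by simp
    have "(r * x + s * y) * v + (u * y - v * x) * r = y * (u * r + v * s)" by (simp add: algebra_simps)
    then show "y = (r * x + s * y) * v + (u * y - v * x) * r" using rs by simp
  qed
  have kclass: "d dvd j * A + t * B - c \<longleftrightarrow> e dvd j - k t" if "h dvd t - t0" for j t
  proof -
    have "j * A + t * B - c = (j - k t) * A + (k t * A + t * B - c)" by (simp add: algebra_simps)
    then have "d dvd j * A + t * B - c \<longleftrightarrow> d dvd (j - k t) * A" using k[OF that] by (simp only: dvd_add_left_iff)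
    also have "(j - k t) * A = h * ((j - k t) * w)" by (simp add: w)
    also have "d dvd h * ((j - k t) * w) \<longleftrightarrow> e dvd (j - k t) * w" using hpos by (simp add: h(2))
    also have "\<dots> \<longleftrightarrow> e dvd j - k t" using ew by (simp add: coprime_dvd_mult_left_iff)
    finally show ?thesis .
  qed
  have yJ: "y \<in> J \<longleftrightarrow> u * y1 \<le> u * y \<and> u * y < u * (y1 + Y)" for y
    using uv(2) by (simp add: J_def)
  \<comment> \<open>A point on a line is determined by its \<open>x\<close>. Steps of
    \<open>e\<close> in the coordinate \<open>k\<close> become steps of \<open>m = e u\<close> in
    \<open>x\<close>, so the solutions on the line are one residue class modulo \<open>m\<close>
    inside the slice \<open>S t\<close>.\<close>
  have line: "card {(x, y) \<in> P. u * y - v * x = t} = card {x \<in> S t. m dvd x - xt t}" if t: "h dvd t - t0" for t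
  proof -
    have "fst ` {(x, y) \<in> P. u * y - v * x = t} = {x \<in> S t. m dvd x - xt t}"
    proof (rule equalityI; clarsimp)
      fix x y assume mem: "(x, y) \<in> P" and teq: "t = u * y - v * x"
      define j where "j = r * x + s * y"
      have xy: "x = j * u - t * s" "y = j * v + t * r" unfolding j_def teq by (rule coords)+
      have "d dvd j * A + t * B - c" using mem lin[OF xy] by (simp add: P_def)
      then have "e dvd j - k t" using kclass[OF t] by blast
      then have "e * u dvd (j - k t) * u" by (rule mult_dvd_mono) simp
      also have "(j - k t) * u = x - xt t" unfolding xt_def xy(1) by (simp add: algebra_simps)
      finally have "m dvd x - xt t" unfolding m_def .
      moreover have "x \<in> S t" using mem yJ[of y] unfolding S_def P_def teq by simp
      ultimately show "x \<in> S (u * y - v * x) \<and> m dvd x - xt (u * y - v * x)" unfolding teq by blast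
    next
      fix x assume x: "x \<in> S t" "m dvd x - xt t"
      then obtain i where "x - xt t = e * u * i" unfolding m_def by (auto elim: dvdE)
      then have xe: "x = (k t + e * i) * u - t * s" unfolding xt_def by (simp add: algebra_simps)
      define y where "y = (k t + e * i) * v + t * r"
      have "u * y - v * x = t * (u * r + v * s)" unfolding xe y_def by (simp add: algebra_simps)
      then have ty: "u * y - v * x = t" using rs by simp
      have "d dvd a * x + b * y - c"
        unfolding lin[OF xe y_def] using kclass[OF t, of "k t + e * i"] by simp
      moreover have "u * y = v * x + t" using ty by simp
      then have "y \<in> J" using x(1) yJ[of y] unfolding S_def by simp
      ultimately have "(x, y) \<in> P" using x(1) unfolding P_def S_def by simp
      with ty show "x \<in> fst ` {(x, y). (x, y) \<in> P \<and> u * y - v * x = t}"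
        by (intro image_eqI[of _ _ "(x, y)"]) auto
    qed
    moreover have "inj_on fst {(x, y) \<in> P. u * y - v * x = t}"
      using uv(2) by (auto intro!: inj_onI)
    ultimately show ?thesis by (metis (no_types, lifting) card_image)
  qed
  have finP: "finite P" by (rule finite_subset[of _ "I \<times> J"]) (auto simp: P_def I_def J_def)
  have finS: "finite (S t)" for t by (rule finite_subset[of _ I]) (auto simp: S_def I_def)
  have finT: "finite T" unfolding T_def using finite_atLeastAtMost_int by (rule rev_finite_subset) blast
  have vx: "\<bar>v * x - v * x1\<bar> \<le> u * X" if "x \<in> I" for x
  proof -
    have "\<bar>v * x - v * x1\<bar> = \<bar>v\<bar> * \<bar>x - x1\<bar>" by (simp add: abs_mult[symmetric] algebra_simps)
    also have "\<dots> \<le> u * X" using that uv by (intro mult_mono) (auto simp: I_def)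
    finally show ?thesis .
  qed
  have range: "t \<in> T" if "x \<in> S t" "h dvd t - t0" for x t
  proof -
    have "u * (y1 + Y) = u * y1 + u * Y" by (simp add: algebra_simps)
    then show ?thesis using that vx[of x] unfolding S_def T_def mem_Collect_eq atLeastAtMost_iff by linarith
  qed
  have "card P = card (\<Union>t\<in>T. {(x, y) \<in> P. u * y - v * x = t})"
  proof (rule arg_cong[of _ _ card], rule equalityI; clarsimp)
    fix x y assume mem: "(x, y) \<in> P"
    define t where "t = u * y - v * x"
    have xy: "x = (r * x + s * y) * u - t * s" "y = (r * x + s * y) * v + t * r" unfolding t_def by (rule coords)+
    have "d dvd (r * x + s * y) * A + t * B - c" using mem lin[OF xy] by (simp add: P_def)
    then have "h dvd (r * x + s * y) * A + t * B - c" unfolding h(2) by (rule dvd_mult_left)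
    moreover have "(r * x + s * y) * A + t * B - c = h * ((r * x + s * y) * w) + (t * B - c)" by (simp add: w algebra_simps)
    ultimately have "h dvd t * B - c" by (simp only: dvd_add_right_iff[OF dvd_triv_left])
    then have "h dvd t - t0" by (simp only: tclass)
    moreover have "x \<in> S t" using mem yJ[of y] unfolding S_def P_def t_def by simp
    ultimately show "u * y - v * x \<in> T" using range unfolding t_def by blast
  qed
  also have "\<dots> = (\<Sum>t\<in>T. card {(x, y) \<in> P. u * y - v * x = t})"
    using finP finT by (intro card_UN_disjoint) (auto intro: finite_subset[of _ P])
  also have "\<dots> = (\<Sum>t\<in>T. card {x \<in> S t. m dvd x - xt t})"
    by (intro sum.cong line) (auto simp: T_def)
  finally have cardP: "real (card P) = (\<Sum>t\<in>T. real (card {x \<in> S t. m dvd x - xt t}))" by simp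
  have lineerr: "\<bar>real (card {x \<in> S t. m dvd x - xt t}) - card (S t) / m\<bar> \<le> 1" for t
  proof (rule card_residue_class_convex[OF mpos finS])
    fix x y z assume *: "x \<in> S t" "z \<in> S t" "x \<le> y" "y \<le> z"
    \<comment> \<open>A linear function of \<open>x\<close> lies between its values at the
      endpoints, whatever the sign of \<open>v\<close>, so each slice is a block of consecutive
      integers.\<close>
    have "v * y \<le> max (v * x) (v * z)" "min (v * x) (v * z) \<le> v * y"
      using *(3,4) by (cases "v \<ge> 0"; simp add: le_max_iff_disj min_le_iff_disj mult_left_mono mult_left_mono_neg)+
    then show "y \<in> S t" using * unfolding S_def I_def by (auto simp: max_def min_def split: if_splits)
  qed
  \<comment> \<open>The total length of the slices is evaluated by columns. For a fixed
    \<open>x\<close>, the admissible \<open>t\<close> form one class modulo \<open>h\<close> in an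
    interval of \<open>u Y\<close> integers, so a column contributes \<open>u Y / h\<close> up to 1,
    and the total error is at most \<open>X\<close>.\<close>
  have "(\<Sum>t\<in>T. card (S t)) = (\<Sum>t\<in>T. \<Sum>x\<in>I. if x \<in> S t then 1 else 0)"
    by (intro sum.cong refl) (simp add: S_def I_def sum.If_cases Int_def conj_commute cong: conj_cong)
  also have "\<dots> = (\<Sum>x\<in>I. \<Sum>t\<in>T. if x \<in> S t then 1 else 0)" by (rule sum.swap)
  also have "\<dots> = (\<Sum>x\<in>I. card {t \<in> {u * y1 - v * x..u * (y1 + Y) - v * x - 1}. h dvd t - t0})"
  proof (intro sum.cong refl)
    fix x assume x: "x \<in> I"
    have "(\<Sum>t\<in>T. if x \<in> S t then 1 else 0) = card {t \<in> T. x \<in> S t}" using finT by (simp add: sum.If_cases Int_def)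
    also have "{t \<in> T. x \<in> S t} = {t \<in> {u * y1 - v * x..u * (y1 + Y) - v * x - 1}. h dvd t - t0}"
      using x range[of x] by (auto simp: S_def T_def)
    finally show "(\<Sum>t\<in>T. if x \<in> S t then 1 else 0) = card {t \<in> {u * y1 - v * x..u * (y1 + Y) - v * x - 1}. h dvd t - t0}" .
  qed
  finally have swap: "(\<Sum>t\<in>T. real (card (S t))) = (\<Sum>x\<in>I. real (card {t \<in> {u * y1 - v * x..u * (y1 + Y) - v * x - 1}. h dvd t - t0}))"
    by (metis (mono_tags, lifting) of_nat_sum sum.cong)
  have colerr: "\<bar>real (card {t \<in> {u * y1 - v * x..u * (y1 + Y) - v * x - 1}. h dvd t - t0}) - u * Y / h\<bar> \<le> 1" for x
  proof -
    have "0 \<le> u * int Y" using uv by simp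
    then show ?thesis
      using card_residue_class_interval[OF hpos, of "u * y1 - v * x" "u * (y1 + Y) - v * x - 1" t0]
      by (simp add: algebra_simps)
  qed
  have cardI: "card I = X" by (simp add: I_def)
  have "\<bar>(\<Sum>t\<in>T. real (card (S t))) - X * (u * Y / h)\<bar> \<le> X"
  proof -
    have "\<bar>(\<Sum>t\<in>T. real (card (S t))) - X * (u * Y / h)\<bar> =
      \<bar>\<Sum>x\<in>I. real (card {t \<in> {u * y1 - v * x..u * (y1 + Y) - v * x - 1}. h dvd t - t0}) - u * Y / h\<bar>"
      unfolding swap sum_subtractf by (simp add: cardI)
    also have "\<dots> \<le> (\<Sum>x\<in>I. \<bar>real (card {t \<in> {u * y1 - v * x..u * (y1 + Y) - v * x - 1}. h dvd t - t0}) - u * Y / h\<bar>)"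
      by (rule sum_abs)
    also have "\<dots> \<le> (\<Sum>x\<in>I. 1)" by (intro sum_mono colerr)
    finally show ?thesis by (simp add: cardI)
  qed
  then have main: "\<bar>(\<Sum>t\<in>T. card (S t) / m) - X * Y / d\<bar> \<le> X / m"
  proof -
    have mr: "real_of_int m > 0" using mpos by simp
    have "(\<Sum>t\<in>T. card (S t) / m) - X * Y / d = ((\<Sum>t\<in>T. real (card (S t))) - X * (u * Y / h)) / m"
      using uv(2) hpos epos by (simp add: sum_divide_distrib[symmetric] h(2) m_def field_simps)
    then have "\<bar>(\<Sum>t\<in>T. card (S t) / m) - X * Y / d\<bar> = \<bar>(\<Sum>t\<in>T. real (card (S t))) - X * (u * Y / h)\<bar> / m"
      using mr by (simp add: abs_divide)
    then show ?thesis using \<open>\<bar>(\<Sum>t\<in>T. real (card (S t))) - X * (u * Y / h)\<bar> \<le> X\<close> mr by (simp add: divide_right_mono)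
  qed
  have "\<bar>real (card P) - (\<Sum>t\<in>T. card (S t) / m)\<bar> \<le> card T"
  proof -
    have "\<bar>real (card P) - (\<Sum>t\<in>T. card (S t) / m)\<bar> = \<bar>\<Sum>t\<in>T. real (card {x \<in> S t. m dvd x - xt t}) - card (S t) / m\<bar>"
      by (simp add: cardP sum_subtractf)
    also have "\<dots> \<le> (\<Sum>t\<in>T. 1)"
      by (rule order.trans[OF sum_abs]) (intro sum_mono lineerr)
    finally show ?thesis by simp
  qed
  \<comment> \<open>Each line costs an error of 1, so the number of lines matters. It is about
    \<open>(2 X + Y) u / h\<close>, and \<open>(e u)^2 \<le> d = h e\<close> gives
    \<open>u * (e u) \<le> h\<close>, that is, \<open>u / h \<le> 1 / m\<close>.\<close>
  moreover have "card T \<le> 3 * K / m + 2"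
  proof -
    have nn: "0 \<le> u * int X" "0 \<le> u * int Y" using uv by simp_all
    have "real (card T) \<le> (u * (2 * X + Y) + 1) / h + 1"
      using card_residue_class_interval[OF hpos, of "u * y1 - v * x1 - u * X" "u * y1 - v * x1 + u * X + u * Y" t0] nn
      unfolding T_def[symmetric] by (simp add: algebra_simps abs_le_iff)
    also have "\<dots> \<le> (2 * X + Y) * (u / h) + 2" using hpos by (simp add: field_simps)
    also have "\<dots> \<le> (3 * K) * (1 / m) + 2"
    proof -
      have "(e * u) * (e * u) \<le> e * h" using small by (simp add: h(2) power2_eq_square mult.commute)
      then have "e * (u * (e * u)) \<le> e * h" by (simp add: ac_simps)
      then have "u * (e * u) \<le> h" using epos by (simp only: mult_le_cancel_left_pos)
      then have "real_of_int u * real_of_int m \<le> real_of_int h" unfolding m_def by (metis of_int_le_iff of_int_mult)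
      then have "real_of_int u / h \<le> 1 / m" using hpos mpos by (simp add: field_simps)
      then show ?thesis using K uv(2) hpos by (intro add_mono mult_mono) auto
    qed
    finally show ?thesis by simp
  qed
  moreover have "X / m \<le> K / m" using K mpos by (simp add: divide_right_mono)
  moreover have "4 * K / m = 3 * K / m + K / m" by simp
  ultimately have "\<bar>real (card P) - X * Y / d\<bar> \<le> 4 * K / m + 2" using main by linarith
  then show ?thesis unfolding P_def I_def J_def m_def by simp
qed

text \<open>Pigeonhole: with \<open>R = \<lfloor>sqrt d\<rfloor>\<close> the box
  \<open>{0..R} \<times> {0..R}\<close> has more than \<open>d\<close> points, so two of them give
  the same value of \<open>a x + b y\<close> modulo \<open>d\<close>; their difference is the
  vector.\<close>

lemma thue_int:
  fixes a b :: int and d :: nat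
  assumes "d > 0"
  obtains u v :: int where "(u, v) \<noteq> (0, 0)" "u\<^sup>2 \<le> int d" "v\<^sup>2 \<le> int d" "int d dvd a * u + b * v"
proof -
  define R where "R = nat \<lfloor>sqrt d\<rfloor>"
  have R: "int R * int R \<le> int d" "int d < (int R + 1) * (int R + 1)"
  proof -
    have "real R = real_of_int \<lfloor>sqrt d\<rfloor>" by (simp add: R_def)
    then have "real R \<le> sqrt d" "sqrt d < real R + 1" by linarith+
    then have "real R * real R \<le> sqrt d * sqrt d" "sqrt d * sqrt d < (real R + 1) * (real R + 1)"
      by (intro mult_mono mult_strict_mono; simp)+
    then have "real (R * R) \<le> real d" "real d < real ((R + 1) * (R + 1))" by (simp_all add: algebra_simps)
    then have "R * R \<le> d" "d < (R + 1) * (R + 1)" by (simp_all only: of_nat_le_iff of_nat_less_iff)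
    then have "int (R * R) \<le> int d" "int d < int ((R + 1) * (R + 1))" by (simp_all only: of_nat_le_iff of_nat_less_iff)
    then show "int R * int R \<le> int d" "int d < (int R + 1) * (int R + 1)" by (simp_all add: algebra_simps)
  qed
  define f where "f = (\<lambda>(x, y). (a * x + b * y) mod int d)"
  let ?A = "{0..int R} \<times> {0..int R}"
  have "\<not> inj_on f ?A"
  proof
    assume "inj_on f ?A"
    then have "card ?A \<le> card {0..<int d}"
      using assms by (intro card_inj_on_le[of f]) (auto simp: f_def)
    moreover have "card ?A = (R + 1) * (R + 1)" by (simp add: card_cartesian_product nat_add_distrib)
    ultimately have "(R + 1) * (R + 1) \<le> d" by simp
    then have "int ((R + 1) * (R + 1)) \<le> int d" by (simp only: of_nat_le_iff)
    then show False using R(2) by (simp add: algebra_simps)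
  qed
  then obtain p q where "p \<in> ?A" "q \<in> ?A" "p \<noteq> q" "f p = f q" unfolding inj_on_def by blast
  then obtain x y x' y' where *: "(x, y) \<in> ?A" "(x', y') \<in> ?A" "(x, y) \<noteq> (x', y')" "f (x, y) = f (x', y')"
    by (metis surj_pair)
  have sq: "(z - z')\<^sup>2 \<le> int d" if "z \<in> {0..int R}" "z' \<in> {0..int R}" for z z'
  proof -
    have "\<bar>z - z'\<bar> \<le> \<bar>int R\<bar>" using that by auto
    then have "(z - z')\<^sup>2 \<le> (int R)\<^sup>2" by (simp only: abs_le_square_iff)
    then show ?thesis using R(1) by (simp add: power2_eq_square)
  qed
  have "int d dvd (a * x + b * y) - (a * x' + b * y')" using *(4) by (simp add: f_def mod_eq_dvd_iff)
  then have "int d dvd a * (x - x') + b * (y - y')" by (simp add: algebra_simps)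
  moreover have "(x - x', y - y') \<noteq> (0, 0)" using *(3) by auto
  moreover have "(x - x')\<^sup>2 \<le> int d" "(y - y')\<^sup>2 \<le> int d" using *(1,2) by (auto intro!: sq)
  ultimately show ?thesis using that by blast
qed

text \<open>Removing the gcd \<open>g\<close> from the vector given by pigeonhole yields a primitive
  direction. Its shortest multiple in the lattice is by \<open>e\<close>, and \<open>e\<close>
  divides \<open>g\<close>, so that multiple is still within the square root of
  \<open>d\<close>.\<close>

lemma lattice_count:
  fixes a b c x1 y1 :: int and d X Y :: nat and K :: real
  assumes d: "d > 0" and cop: "\<And>q. prime q \<Longrightarrow> q dvd a \<Longrightarrow> q dvd b \<Longrightarrow> \<not> q dvd int d"
    and K: "real X \<le> K" "real Y \<le> K"
  obtains u v :: int where "(u, v) \<noteq> (0, 0)" "u\<^sup>2 \<le> int d" "v\<^sup>2 \<le> int d" "int d dvd a * u + b * v"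
    "\<bar>real (card {(x, y). x \<in> {x1..<x1 + X} \<and> y \<in> {y1..<y1 + Y} \<and> int d dvd a * x + b * y - c}) -
      real X * real Y / d\<bar> \<le> 4 * K / max \<bar>u\<bar> \<bar>v\<bar> + 2"
proof -
  obtain u' v' where uv': "(u', v') \<noteq> (0, 0)" "u'\<^sup>2 \<le> int d" "v'\<^sup>2 \<le> int d" "int d dvd a * u' + b * v'"
    using thue_int[OF d] by blast
  define g where "g = gcd u' v'"
  have gpos: "g > 0" using uv'(1) by (auto simp: g_def)
  obtain u v where uv: "u' = u * g" "v' = v * g" "coprime u v"
    using gcd_coprime_exists[of u' v'] gpos unfolding g_def by (metis less_irrefl)
  define h where "h = gcd (int d) (a * u + b * v)"
  have hpos: "h > 0" using d by (simp add: h_def)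
  have "h dvd int d" by (simp add: h_def)
  then obtain e where e: "int d = h * e" by (rule dvdE)
  have epos: "e > 0" using e d hpos by (metis of_nat_0_less_iff zero_less_mult_pos)
  have "h dvd a * u + b * v" by (simp add: h_def)
  then obtain w where w: "a * u + b * v = h * w" by (rule dvdE)
  have ew: "coprime e w"
  proof -
    have "h = gcd (h * e) (h * w)" unfolding e[symmetric] w[symmetric] by (rule h_def)
    also have "\<dots> = \<bar>h\<bar> * gcd e w" by (rule gcd_mult_distrib_int[symmetric])
    finally show ?thesis using hpos by (simp add: coprime_iff_gcd_eq_1)
  qed
  have "h * e dvd h * (w * g)"
  proof -
    have "a * u' + b * v' = h * w * g" unfolding uv(1,2) w[symmetric] by (simp add: algebra_simps)
    then show ?thesis using uv'(4) unfolding e by (simp add: mult.assoc)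
  qed
  then have "e dvd w * g" using hpos by simp
  then have "e dvd g" using ew by (simp add: coprime_dvd_mult_right_iff)
  then have "e \<le> g" using gpos by (rule zdvd_imp_le)
  have small: "(e * z)\<^sup>2 \<le> int d" if "(z * g)\<^sup>2 \<le> int d" for z
  proof -
    have "\<bar>e * z\<bar> \<le> \<bar>z * g\<bar>" using \<open>e \<le> g\<close> epos gpos
      by (simp add: abs_mult mult.commute mult_right_mono)
    then have "(e * z)\<^sup>2 \<le> (z * g)\<^sup>2" by (simp only: abs_le_square_iff)
    then show ?thesis using that by linarith
  qed
  have su: "(e * u)\<^sup>2 \<le> int d" and sv: "(e * v)\<^sup>2 \<le> int d" using small uv'(2,3) uv(1,2) by simp_all
  have dvd: "int d dvd a * (e * u) + b * (e * v)"
  proof -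
    have "a * (e * u) + b * (e * v) = h * e * w" using w by (simp add: algebra_simps) (metis distrib_left mult.left_commute)
    then show ?thesis by (simp add: e)
  qed
  have dpos: "int d > 0" using d by simp
  have cop': "\<not> q dvd int d" if "prime q" "q dvd b" "q dvd a" for q using cop that by blast
  have nz: "(e * u, e * v) \<noteq> (0, 0)" using uv uv'(1) epos by auto
  let ?E = "\<lambda>m. \<bar>real (card {(x, y). x \<in> {x1..<x1 + X} \<and> y \<in> {y1..<y1 + Y} \<and> int d dvd a * x + b * y - c}) -
      real X * real Y / d\<bar> \<le> 4 * K / m + 2"
  \<comment> \<open>The sign \<open>\<sigma>\<close> makes the dominant coordinate positive, and the
    two coordinates are exchanged when \<open>v\<close> dominates; this reaches the normalisation
    \<open>u > 0\<close>, \<open>\<bar>v\<bar> \<le> u\<close> of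
    \<open>lattice_count_primitive\<close>.\<close>
  have main: "?E (real_of_int (max \<bar>e * u\<bar> \<bar>e * v\<bar>))"
  proof (cases "\<bar>v\<bar> \<le> \<bar>u\<bar>")
    case True
    define \<sigma> where "\<sigma> = sgn u"
    have u0: "u \<noteq> 0" using True nz by auto
    have sig: "\<sigma> = 1 \<or> \<sigma> = - 1" using u0 by (auto simp: \<sigma>_def sgn_if)
    have "?E (real_of_int (e * (\<sigma> * u)))"
    proof -
      have "h = gcd (int d) (a * (\<sigma> * u) + b * (\<sigma> * v))"
      proof -
        have "a * (\<sigma> * u) + b * (\<sigma> * v) = \<sigma> * (a * u + b * v)" by (simp add: algebra_simps)
        moreover have "gcd (int d) (\<sigma> * z) = gcd (int d) z" for z using sig by auto
        ultimately show ?thesis unfolding h_def by simp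
      qed
      note 1 = this
      have 2: "coprime (\<sigma> * u) (\<sigma> * v)" using sig uv(3) by auto
      have 3: "\<sigma> * u > 0" using u0 by (simp add: \<sigma>_def sgn_if)
      have 4: "\<bar>\<sigma> * v\<bar> \<le> \<sigma> * u" using True u0 by (auto simp: \<sigma>_def sgn_if)
      have 5: "(e * (\<sigma> * u))\<^sup>2 \<le> int d" using su sig by auto
      from lattice_count_primitive[OF dpos cop 2 3 4 1 e 5 K, of x1 y1 c] show ?thesis by simp
    qed
    moreover have "e * (\<sigma> * u) = max \<bar>e * u\<bar> \<bar>e * v\<bar>"
      using True epos by (auto simp: \<sigma>_def abs_mult max_def sgn_if)
    ultimately show ?thesis by simp
  next
    case False
    define \<sigma> where "\<sigma> = sgn v"
    have v0: "v \<noteq> 0" using False by auto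
    have sig: "\<sigma> = 1 \<or> \<sigma> = - 1" using v0 by (auto simp: \<sigma>_def sgn_if)
    have swap: "card {(y, x). y \<in> {y1..<y1 + Y} \<and> x \<in> {x1..<x1 + X} \<and> int d dvd b * y + a * x - c} =
        card {(x, y). x \<in> {x1..<x1 + X} \<and> y \<in> {y1..<y1 + Y} \<and> int d dvd a * x + b * y - c}"
      by (rule bij_betw_same_card[of prod.swap], rule bij_betwI[where g = prod.swap]) (auto simp: add.commute)
    have "?E (real_of_int (e * (\<sigma> * v)))"
    proof -
      have "h = gcd (int d) (b * (\<sigma> * v) + a * (\<sigma> * u))"
      proof -
        have "b * (\<sigma> * v) + a * (\<sigma> * u) = \<sigma> * (a * u + b * v)" by (simp add: algebra_simps)
        moreover have "gcd (int d) (\<sigma> * z) = gcd (int d) z" for z using sig by auto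
        ultimately show ?thesis unfolding h_def by simp
      qed
      note 1 = this
      have 2: "coprime (\<sigma> * v) (\<sigma> * u)" using sig uv(3) by (auto simp: coprime_commute)
      have 3: "\<sigma> * v > 0" using v0 by (simp add: \<sigma>_def sgn_if)
      have 4: "\<bar>\<sigma> * u\<bar> \<le> \<sigma> * v" using False v0 by (auto simp: \<sigma>_def sgn_if)
      have 5: "(e * (\<sigma> * v))\<^sup>2 \<le> int d" using sv sig by auto
      from lattice_count_primitive[OF dpos cop' 2 3 4 1 e 5 K(2,1), of y1 x1 c] show ?thesis
        unfolding swap by (simp add: mult.commute[of "real Y"])
    qed
    moreover have "e * (\<sigma> * v) = max \<bar>e * u\<bar> \<bar>e * v\<bar>"
      using False epos by (auto simp: \<sigma>_def abs_mult max_def sgn_if)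
    ultimately show ?thesis by simp
  qed
  show ?thesis by (rule that[OF nz su sv dvd main])
qed

subsection \<open>Lifting roots to square moduli\<close>

text \<open>Split each coordinate by division with remainder by \<open>d\<close>. Expanding the
  squares, the terms in \<open>i^2\<close> and \<open>j^2\<close> are multiples of
  \<open>d^2\<close>, and dividing what remains by \<open>d\<close> leaves a congruence modulo
  \<open>d\<close> that is linear in \<open>(i, j)\<close>.\<close>

lemma card_square_dvd_eq_sum:
  fixes A B :: int and d :: nat
  assumes d: "d > 0"
  shows "card {(x, y). x \<in> {A..B} \<and> y \<in> {A..B} \<and> (int d)\<^sup>2 dvd x\<^sup>2 + y\<^sup>2 + 1} =
    (\<Sum>(x, y)\<in>roots_on_line 0 0 d. card {(i, j). x + int d * i \<in> {A..B} \<and> y + int d * j \<in> {A..B} \<and>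
       int d dvd 2 * x * i + 2 * y * j - (- ((x\<^sup>2 + y\<^sup>2 + 1) div int d))})"
proof -
  define L where "L = (\<lambda>(x, y). {(i, j). x + int d * i \<in> {A..B} \<and> y + int d * j \<in> {A..B} \<and>
       int d dvd 2 * x * i + 2 * y * j - (- ((x\<^sup>2 + y\<^sup>2 + 1) div int d))})"
  define M where "M = {(x, y). x \<in> {A..B} \<and> y \<in> {A..B} \<and> (int d)\<^sup>2 dvd x\<^sup>2 + y\<^sup>2 + 1}"
  \<comment> \<open>The inner minus puts the congruence in the form \<open>a i + b j - c\<close> of \<open>lattice_count\<close>.\<close>
  have lift: "(int d)\<^sup>2 dvd (x + int d * i)\<^sup>2 + (y + int d * j)\<^sup>2 + 1 \<longleftrightarrow>
      int d dvd 2 * x * i + 2 * y * j - (- ((x\<^sup>2 + y\<^sup>2 + 1) div int d))"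
    if root: "int d dvd x\<^sup>2 + y\<^sup>2 + 1" for x y i j
  proof -
    obtain z where z: "x\<^sup>2 + y\<^sup>2 + 1 = int d * z" using root by (rule dvdE)
    have "(x + int d * i)\<^sup>2 + (y + int d * j)\<^sup>2 + 1 =
        (x\<^sup>2 + y\<^sup>2 + 1) + int d * (2 * x * i + 2 * y * j) + (int d)\<^sup>2 * (i\<^sup>2 + j\<^sup>2)"
      by (simp add: power2_eq_square algebra_simps)
    also have "\<dots> = int d * (2 * x * i + 2 * y * j + z) + (int d)\<^sup>2 * (i\<^sup>2 + j\<^sup>2)"
      unfolding z by (simp add: algebra_simps)
    finally have "(int d)\<^sup>2 dvd (x + int d * i)\<^sup>2 + (y + int d * j)\<^sup>2 + 1 \<longleftrightarrow>
        (int d)\<^sup>2 dvd int d * (2 * x * i + 2 * y * j + z)"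
      by (simp only: dvd_add_left_iff[OF dvd_triv_left])
    also have "\<dots> \<longleftrightarrow> int d dvd 2 * x * i + 2 * y * j + z" using d by (simp add: power2_eq_square)
    finally show ?thesis unfolding z using d by simp
  qed
  have "bij_betw (\<lambda>((x, y), (i, j)). (x + int d * i, y + int d * j)) (SIGMA p:roots_on_line 0 0 d. L p) M"
  proof (rule bij_betwI[where g = "\<lambda>(x, y). ((x mod int d, y mod int d), (x div int d, y div int d))"])
    show "(\<lambda>((x, y), (i, j)). (x + int d * i, y + int d * j)) \<in> (SIGMA p:roots_on_line 0 0 d. L p) \<rightarrow> M"
      using lift by (auto simp: L_def M_def roots_on_line_def)
    show "(\<lambda>(x, y). ((x mod int d, y mod int d), (x div int d, y div int d))) \<in> M \<rightarrow> (SIGMA p:roots_on_line 0 0 d. L p)"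
    proof (clarsimp simp: M_def)
      fix x y assume *: "A \<le> x" "x \<le> B" "A \<le> y" "y \<le> B" "(int d)\<^sup>2 dvd x\<^sup>2 + y\<^sup>2 + 1"
      have "int d dvd x\<^sup>2 + y\<^sup>2 + 1" using *(5) unfolding power2_eq_square[of "int d"] by (rule dvd_mult_left)
      then have mem: "(x mod int d, y mod int d) \<in> roots_on_line 0 0 d"
        using mod_mem_roots_on_line_iff[OF d, of x y 0 0] by simp
      then have dv: "int d dvd (x mod int d)\<^sup>2 + (y mod int d)\<^sup>2 + 1" by (simp add: roots_on_line_def)
      have xy: "x mod int d + int d * (x div int d) = x" "y mod int d + int d * (y div int d) = y" by simp_all
      have "(x div int d, y div int d) \<in> L (x mod int d, y mod int d)"
        unfolding L_def using * lift[OF dv, of "x div int d" "y div int d"] by (simp add: xy)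
      with mem show "(x mod int d, y mod int d) \<in> roots_on_line 0 0 d \<and>
        (x div int d, y div int d) \<in> L (x mod int d, y mod int d)" by blast
    qed
  qed (use d in \<open>auto simp: roots_on_line_def\<close>)
  then have "card M = card (SIGMA p:roots_on_line 0 0 d. L p)" by (simp add: bij_betw_same_card)
  also have "\<dots> = (\<Sum>p\<in>roots_on_line 0 0 d. card (L p))"
  proof (intro card_SigmaI ballI finite_roots_on_line)
    fix p assume "p \<in> roots_on_line 0 0 d"
    have fin: "finite {i. z + int d * i \<in> {A..B}}" for z
    proof -
      have "inj_on (\<lambda>i. z + int d * i) {i. z + int d * i \<in> {A..B}}" using d by (auto intro!: inj_onI)
      then show ?thesis by (rule inj_on_finite[where B = "{A..B}"]) auto
    qed
    obtain x y where p: "p = (x, y)" by force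
    have "L p \<subseteq> {i. x + int d * i \<in> {A..B}} \<times> {j. y + int d * j \<in> {A..B}}" unfolding L_def p by auto
    then show "finite (L p)" by (rule finite_subset) (intro finite_cartesian_product fin)
  qed
  finally show ?thesis unfolding M_def L_def by (simp only: case_prod_unfold)
qed

lemma card_linear_congruence_prime:
  fixes a b c :: int
  assumes p: "prime p" and ab: "\<not> int p dvd a \<or> \<not> int p dvd b"
  shows "card {(i, j). i \<in> {0..<int p} \<and> j \<in> {0..<int p} \<and> int p dvd a * i + b * j - c} = p"
proof -
  have main: "card {(i, j). i \<in> {0..<int p} \<and> j \<in> {0..<int p} \<and> int p dvd a * i + b * j - c} = p"
    if "\<not> int p dvd a" for a b
  proof -
    let ?S = "{(i, j). i \<in> {0..<int p} \<and> j \<in> {0..<int p} \<and> int p dvd a * i + b * j - c}"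
    have "coprime a (int p)" using prime_imp_coprime[of "int p" a] that p by (simp add: coprime_commute)
    then obtain a' where "[a * a' = 1] (mod int p)" using cong_solve_coprime_int by blast
    then have a': "int p dvd a * a' - 1" by (simp only: cong_iff_dvd_diff)
    have "bij_betw snd ?S {0..<int p}"
    proof (rule bij_betwI[where g = "\<lambda>j. ((a' * (c - b * j)) mod int p, j)"])
      show "(\<lambda>j. ((a' * (c - b * j)) mod int p, j)) \<in> {0..<int p} \<rightarrow> ?S"
      proof
        fix j assume j: "j \<in> {0..<int p}"
        have "[a * ((a' * (c - b * j)) mod int p) + b * j - c = a * (a' * (c - b * j)) + b * j - c] (mod int p)"
          by (intro cong_diff cong_add cong_mult cong_refl) (simp add: unique_euclidean_semiring_class.cong_def)
        then have "int p dvd a * ((a' * (c - b * j)) mod int p) + b * j - c \<longleftrightarrow>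
            int p dvd a * (a' * (c - b * j)) + b * j - c"
          by (rule cong_dvd_iff)
        moreover have "a * (a' * (c - b * j)) + b * j - c = (a * a' - 1) * (c - b * j)" by (simp add: algebra_simps)
        ultimately show "((a' * (c - b * j)) mod int p, j) \<in> ?S"
          using j a' prime_gt_0_nat[OF p] by simp
      qed
      show "((a' * (c - b * snd q)) mod int p, snd q) = q" if "q \<in> ?S" for q
      proof -
        obtain i j where q: "q = (i, j)" by force
        have *: "0 \<le> i" "i < int p" "int p dvd a * i + b * j - c" using that q by auto
        have "int p dvd (a * a' - 1) * (- i) + a' * (a * i + b * j - c)" using a' *(3) by (intro dvd_add dvd_mult dvd_mult2)
        moreover have "(a * a' - 1) * (- i) + a' * (a * i + b * j - c) = i - a' * (c - b * j)" by (simp add: algebra_simps)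
        ultimately have "int p dvd i - a' * (c - b * j)" by simp
        then have "i mod int p = (a' * (c - b * j)) mod int p" by (simp only: mod_eq_dvd_iff)
        then show ?thesis using * q by simp
      qed
    qed auto
    then show ?thesis using bij_betw_same_card by fastforce
  qed
  show ?thesis
  proof (cases "int p dvd a")
    case False
    then show ?thesis by (rule main)
  next
    case True
    have "card {(i, j). i \<in> {0..<int p} \<and> j \<in> {0..<int p} \<and> int p dvd a * i + b * j - c} =
        card {(j, i). j \<in> {0..<int p} \<and> i \<in> {0..<int p} \<and> int p dvd b * j + a * i - c}"
      by (rule bij_betw_same_card[of prod.swap], rule bij_betwI[where g = prod.swap]) (auto simp: add.commute)
    then show ?thesis using main[of b a] True ab by simp
  qed
qed

text \<open>Guarantees that the linear congruence above a root is never degenerate at an odd prime: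
  otherwise \<open>q\<close> would divide both \<open>x\<close> and \<open>y\<close>, and therefore
  1.\<close>

lemma prime_not_dvd_root:
  fixes q x y :: int
  assumes "prime q" "q dvd x\<^sup>2 + y\<^sup>2 + 1" "odd q" "q dvd 2 * x" "q dvd 2 * y"
  shows False
proof -
  have "\<not> q dvd 2" using assms(1,3) primes_dvd_imp_eq[of q 2] by auto
  then have "q dvd x" "q dvd y" using assms by (auto simp: prime_dvd_mult_iff)
  then have "q dvd (x\<^sup>2 + y\<^sup>2 + 1) - x\<^sup>2 - y\<^sup>2"
    using assms(2) by (intro dvd_diff) (auto simp: power2_eq_square)
  then show False using prime_gt_1_int[OF assms(1)] by simp
qed

text \<open>Hensel lifting: the gradient \<open>(2 x, 2 y)\<close> is nonzero modulo
  \<open>p\<close> at every root, so each root modulo \<open>p\<close> has exactly \<open>p\<close>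
  lifts modulo \<open>p^2\<close>.\<close>

lemma card_roots_prime_square:
  assumes p: "prime p" "odd p"
  shows "card (roots_on_line 0 0 (p\<^sup>2)) = p * card (roots_on_line 0 0 p)"
proof -
  have p0: "p > 0" using p prime_gt_0_nat by blast
  have "roots_on_line 0 0 (p\<^sup>2) =
      {(x, y). x \<in> {0..(int p)\<^sup>2 - 1} \<and> y \<in> {0..(int p)\<^sup>2 - 1} \<and> (int p)\<^sup>2 dvd x\<^sup>2 + y\<^sup>2 + 1}"
    by (auto simp: roots_on_line_def)
  then have "card (roots_on_line 0 0 (p\<^sup>2)) = (\<Sum>(x, y)\<in>roots_on_line 0 0 p.
     card {(i, j). x + int p * i \<in> {0..(int p)\<^sup>2 - 1} \<and> y + int p * j \<in> {0..(int p)\<^sup>2 - 1} \<and>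
       int p dvd 2 * x * i + 2 * y * j - (- ((x\<^sup>2 + y\<^sup>2 + 1) div int p))})"
    by (simp only: card_square_dvd_eq_sum[OF p0])
  also have "\<dots> = (\<Sum>(x, y)\<in>roots_on_line 0 0 p. p)"
  proof (rule sum.cong[OF refl], clarify)
    fix x y assume xy: "(x, y) \<in> roots_on_line 0 0 p"
    have range: "z + int p * i \<in> {0..(int p)\<^sup>2 - 1} \<longleftrightarrow> i \<in> {0..<int p}" if "0 \<le> z" "z < int p" for z i
    proof -
      have "z + int p * i \<in> {0..(int p)\<^sup>2 - 1} \<longleftrightarrow> (z + int p * i) div int p \<in> {0..<int p}"
      proof -
        have "0 \<le> (z + int p * i) div int p \<longleftrightarrow> int p * 0 \<le> z + int p * i"
          using p0 by (intro le_div_iff_mult_le_int) simp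
        moreover have "int p \<le> (z + int p * i) div int p \<longleftrightarrow> int p * int p \<le> z + int p * i"
          using p0 by (intro le_div_iff_mult_le_int) simp
        ultimately show ?thesis unfolding power2_eq_square atLeastAtMost_iff atLeastLessThan_iff by linarith
      qed
      then show ?thesis using that p0 by simp
    qed
    have "\<not> int p dvd 2 * x \<or> \<not> int p dvd 2 * y"
      using prime_not_dvd_root[of "int p" x y] p xy by (auto simp: roots_on_line_def)
    from card_linear_congruence_prime[OF p(1) this]
    show "card {(i, j). x + int p * i \<in> {0..(int p)\<^sup>2 - 1} \<and> y + int p * j \<in> {0..(int p)\<^sup>2 - 1} \<and>
       int p dvd 2 * x * i + 2 * y * j - (- ((x\<^sup>2 + y\<^sup>2 + 1) div int p))} = p"
      using xy by (simp only: range roots_on_line_def mem_Collect_eq case_prod_conv atLeastLessThan_iff)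
  qed
  finally show ?thesis by simp
qed

lemma not_4_dvd_sum_squares_Suc: "\<not> 4 dvd x\<^sup>2 + y\<^sup>2 + (1 :: int)"
proof
  assume 4: "4 dvd x\<^sup>2 + y\<^sup>2 + 1"
  have sq: "\<exists>k. z\<^sup>2 = 4 * k \<or> z\<^sup>2 = 4 * k + 1" for z :: int
  proof (cases "even z")
    case True
    then obtain k where "z = 2 * k" by (rule evenE)
    then have "z\<^sup>2 = 4 * k\<^sup>2" by simp
    then show ?thesis by blast
  next
    case False
    then obtain k where "z = 2 * k + 1" by (rule oddE)
    then have "z\<^sup>2 = 4 * (k\<^sup>2 + k) + 1" by (simp add: power2_eq_square algebra_simps)
    then show ?thesis by blast
  qed
  obtain k where "x\<^sup>2 = 4 * k \<or> x\<^sup>2 = 4 * k + 1" using sq by blast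
  moreover obtain l where "y\<^sup>2 = 4 * l \<or> y\<^sup>2 = 4 * l + 1" using sq by blast
  ultimately show False using 4 by presburger
qed

text \<open>Disposes of even \<open>d\<close> on both sides of the asymptotic count, so that later
  arguments may assume \<open>d\<close> odd.\<close>

lemma not_even_square_dvd:
  fixes d :: nat
  assumes "even d"
  shows "\<not> (int d)\<^sup>2 dvd x\<^sup>2 + y\<^sup>2 + 1"
proof
  assume "(int d)\<^sup>2 dvd x\<^sup>2 + y\<^sup>2 + 1"
  moreover have "4 dvd (int d)\<^sup>2"
  proof -
    have "(2 :: int) * 2 dvd int d * int d" using assms by (intro mult_dvd_mono) auto
    then show ?thesis by (simp add: power2_eq_square)
  qed
  ultimately show False using not_4_dvd_sum_squares_Suc dvd_trans by blast
qed

text \<open>The proportion of roots among the \<open>d^4\<close> residue pairs modulo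
  \<open>d^2\<close>; at a prime it is the quantity subtracted in
  \<open>local_factor\<close>.\<close>

definition root_density :: "nat \<Rightarrow> real" where
  "root_density d = real (num_roots (d\<^sup>2)) / real d ^ 4"

lemma root_density_nonneg [simp]: "root_density d \<ge> 0"
  by (simp add: root_density_def)

lemma root_density_even:
  assumes "even d" "d > 0"
  shows "root_density d = 0"
proof -
  have "roots_on_line 0 0 (d\<^sup>2) = {}" using not_even_square_dvd[OF assms(1)] by (auto simp: roots_on_line_def)
  then show ?thesis using assms(2) by (simp add: root_density_def num_roots_eq)
qed

lemma root_density_prod:
  assumes "squarefree d"
  shows "root_density d = (\<Prod>p\<in>prime_factors d. root_density p)"
proof -
  have d: "d = \<Prod>(prime_factors d)" using Prod_prime_factors_squarefree[OF assms] by simp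
  have "d > 0" using assms by (cases "d = 0") auto
  then have "real (num_roots (d\<^sup>2)) = (\<Prod>p\<in>prime_factors d. real (num_roots (p\<^sup>2)))"
    using card_roots_on_line_Prod[of "prime_factors d" 0 0 2] d[symmetric]
    by (simp add: num_roots_eq in_prime_factors_imp_prime prime_gt_0_nat)
  moreover have "real d ^ 4 = (\<Prod>p\<in>prime_factors d. real p ^ 4)"
    by (subst d) (simp add: prod_power_distrib)
  ultimately show ?thesis unfolding root_density_def by (simp only: prod_dividef)
qed

text \<open>Lifting at every prime of \<open>d\<close> multiplies the root count by
  \<open>d\<close>. This form matches the expected count \<open>N^2 / d^3\<close> above each single
  root modulo \<open>d\<close>.\<close>

lemma root_density_odd:
  assumes "squarefree d" "odd d"
  shows "root_density d = card (roots_on_line 0 0 d) / real d ^ 3"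
proof -
  have d: "\<Prod>(prime_factors d) = d" using Prod_prime_factors_squarefree[OF assms(1)] by simp
  have d0: "d > 0" using assms by (cases "d = 0") auto
  have "card (roots_on_line 0 0 (d\<^sup>2)) = (\<Prod>p\<in>prime_factors d. card (roots_on_line 0 0 (p\<^sup>2)))"
    using card_roots_on_line_Prod[of "prime_factors d" 0 0 2] d by (simp add: in_prime_factors_imp_prime)
  also have "\<dots> = (\<Prod>p\<in>prime_factors d. p * card (roots_on_line 0 0 p))"
    using assms(2) by (intro prod.cong refl card_roots_prime_square) (auto simp: in_prime_factors_iff dest: dvd_trans)
  also have "\<dots> = d * card (roots_on_line 0 0 d)"
    using card_roots_on_line_Prod[of "prime_factors d" 0 0 1] d by (simp add: prod.distrib in_prime_factors_imp_prime)
  finally show ?thesis using d0 by (simp add: root_density_def num_roots_eq power_numeral_reduce)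
qed

lemma root_density_le:
  assumes "squarefree d"
  shows "root_density d \<le> tau d / real d ^ 2"
proof (cases "even d")
  case True
  then show ?thesis using assms by (cases "d = 0") (simp_all add: root_density_even)
next
  case False
  have d0: "d > 0" using assms by (cases "d = 0") auto
  have "card (roots_on_line 0 0 d) \<le> tau d * d"
    using card_roots_on_line_squarefree_le[OF assms, of 0 0] two_power_card_prime_factors_le_tau[OF assms]
    by (auto intro: order.trans mult_right_mono)
  then have "real (card (roots_on_line 0 0 d)) \<le> real (tau d) * real d" by (metis of_nat_le_iff of_nat_mult)
  then show ?thesis using d0 unfolding root_density_odd[OF assms False]
    by (simp add: field_simps power2_eq_square power3_eq_cube)
qed

subsection \<open>Pairs with a small square divisor\<close>

definition sq_pairs :: "nat \<Rightarrow> nat \<Rightarrow> (int \<times> int) set" where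
  "sq_pairs N d = {(x, y). x \<in> {1..int N} \<and> y \<in> {1..int N} \<and> (int d)\<^sup>2 dvd x\<^sup>2 + y\<^sup>2 + 1}"

text \<open>The admissible \<open>i\<close> and \<open>j\<close> fill a box whose sides differ from
  \<open>N / d\<close> by at most 1, and \<open>lattice_count\<close> applies with coefficients
  \<open>2 x\<close> and \<open>2 y\<close>. The last error term pays for replacing the true sides
  by \<open>N / d\<close>.\<close>

lemma root_fibre_count:
  fixes x y :: int and N d :: nat
  assumes d: "odd d" and xy: "(x, y) \<in> roots_on_line 0 0 d"
  obtains u v :: int where "(u, v) \<noteq> (0, 0)" "u\<^sup>2 \<le> int d" "v\<^sup>2 \<le> int d" "(x, y) \<in> roots_on_line u v d"
    "\<bar>real (card {(i, j). x + int d * i \<in> {1..int N} \<and> y + int d * j \<in> {1..int N} \<and>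
       int d dvd 2 * x * i + 2 * y * j - c}) - (real N)\<^sup>2 / real d ^ 3\<bar> \<le>
      4 * (N / d + 1) / max \<bar>u\<bar> \<bar>v\<bar> + 2 + (2 * (N / d) + 1) / d"
proof -
  have d0: "d > 0" using d by (cases "d = 0") auto
  define Q where "Q = real N / real d"
  have Q0: "Q \<ge> 0" by (simp add: Q_def)
  have ivl: "\<exists>lo X. {i. z + int d * i \<in> {1..int N}} = {lo..<lo + int X} \<and> \<bar>real X - Q\<bar> \<le> 1" for z
  proof -
    define lo hi where "lo = - ((z - 1) div int d)" and "hi = (int N - z) div int d"
    have eq: "{i. z + int d * i \<in> {1..int N}} = {lo..hi}"
      using progression_interval_eq[of "int d" 1 z "int N"] d0 by (simp add: lo_def hi_def)
    have err: "\<bar>real (card {lo..hi}) - Q\<bar> \<le> 1"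
      using card_progression_interval[of "int d" 1 "int N" z] d0 eq by (simp add: Q_def)
    show ?thesis
    proof (cases "lo \<le> hi")
      case True
      then have "{lo..hi} = {lo..<lo + int (card {lo..hi})}" by auto
      then show ?thesis using eq err by blast
    next
      case False
      then show ?thesis using eq err by (intro exI[of _ lo] exI[of _ 0]) auto
    qed
  qed
  obtain x1 X where X: "{i. x + int d * i \<in> {1..int N}} = {x1..<x1 + int X}" "\<bar>real X - Q\<bar> \<le> 1" using ivl by blast
  obtain y1 Y where Y: "{i. y + int d * i \<in> {1..int N}} = {y1..<y1 + int Y}" "\<bar>real Y - Q\<bar> \<le> 1" using ivl by blast
  have dv: "int d dvd x\<^sup>2 + y\<^sup>2 + 1" using xy by (simp add: roots_on_line_def)
  have cop: "\<not> q dvd int d" if "prime q" "q dvd 2 * x" "q dvd 2 * y" for q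
  proof
    assume q: "q dvd int d"
    then have "q dvd x\<^sup>2 + y\<^sup>2 + 1" using dv by (rule dvd_trans)
    moreover have "odd q" using q d dvd_trans[of 2 q "int d"] by auto
    ultimately show False using prime_not_dvd_root that by blast
  qed
  have K: "real X \<le> Q + 1" "real Y \<le> Q + 1" using X(2) Y(2) by linarith+
  obtain u v :: int where uv: "(u, v) \<noteq> (0, 0)" "u\<^sup>2 \<le> int d" "v\<^sup>2 \<le> int d" "int d dvd 2 * x * u + 2 * y * v"
    and err: "\<bar>real (card {(i, j). i \<in> {x1..<x1 + X} \<and> j \<in> {y1..<y1 + Y} \<and> int d dvd 2 * x * i + 2 * y * j - c}) -
      real X * real Y / d\<bar> \<le> 4 * (Q + 1) / max \<bar>u\<bar> \<bar>v\<bar> + 2"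
    by (rule lattice_count[OF d0 cop K]) blast
  \<comment> \<open>The roles are exchanged here: the condition on the vector \<open>(u, v)\<close>
    is read as a condition on the root \<open>(x, y)\<close>, with the factor 2 cancelled because
    \<open>d\<close> is odd.\<close>
  have "int d dvd 2 * (u * x + v * y)" using uv(4) by (simp add: algebra_simps)
  moreover have "coprime (int d) 2" using d by simp
  ultimately have "int d dvd u * x + v * y" by (simp only: coprime_dvd_mult_right_iff)
  then have mem: "(x, y) \<in> roots_on_line u v d" using xy by (simp add: roots_on_line_def)
  have "{(i, j). x + int d * i \<in> {1..int N} \<and> y + int d * j \<in> {1..int N} \<and> int d dvd 2 * x * i + 2 * y * j - c} =
    {(i, j). i \<in> {x1..<x1 + int X} \<and> j \<in> {y1..<y1 + int Y} \<and> int d dvd 2 * x * i + 2 * y * j - c}"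
    using X(1) Y(1) by blast
  moreover have "\<bar>real X * real Y / d - (real N)\<^sup>2 / real d ^ 3\<bar> \<le> (2 * Q + 1) / d"
  proof -
    define \<alpha> \<beta> where "\<alpha> = real X - Q" and "\<beta> = real Y - Q"
    have "real X * real Y - Q\<^sup>2 = Q * \<alpha> + Q * \<beta> + \<alpha> * \<beta>"
      by (simp add: \<alpha>_def \<beta>_def power2_eq_square algebra_simps)
    moreover have "\<bar>Q * \<alpha>\<bar> \<le> Q" "\<bar>Q * \<beta>\<bar> \<le> Q"
      using X(2) Y(2) Q0 by (simp_all add: abs_mult \<alpha>_def \<beta>_def mult_left_le)
    moreover have "\<bar>\<alpha> * \<beta>\<bar> \<le> 1"
      using X(2) Y(2) mult_mono[of "\<bar>\<alpha>\<bar>" 1 "\<bar>\<beta>\<bar>" 1] by (simp add: abs_mult \<alpha>_def \<beta>_def)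
    ultimately have "\<bar>real X * real Y - Q\<^sup>2\<bar> \<le> 2 * Q + 1" by linarith
    then have "\<bar>real X * real Y - Q\<^sup>2\<bar> / d \<le> (2 * Q + 1) / d" by (simp add: divide_right_mono)
    moreover have "real X * real Y / d - (real N)\<^sup>2 / real d ^ 3 = (real X * real Y - Q\<^sup>2) / d"
      using d0 by (simp add: Q_def field_simps power2_eq_square power3_eq_cube)
    ultimately show ?thesis using d0 by (simp add: abs_divide)
  qed
  ultimately have "\<bar>real (card {(i, j). x + int d * i \<in> {1..int N} \<and> y + int d * j \<in> {1..int N} \<and>
       int d dvd 2 * x * i + 2 * y * j - c}) - (real N)\<^sup>2 / real d ^ 3\<bar> \<le>
      4 * (Q + 1) / max \<bar>u\<bar> \<bar>v\<bar> + 2 + (2 * Q + 1) / d"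
    using err by simp
  from this[unfolded Q_def] show ?thesis by (intro that[OF uv(1-3) mem])
qed

text \<open>The origin contributes \<open>1 / 0 = 0\<close>.\<close>

lemma sum_inverse_max_norm_box:
  "(\<Sum>(u, v)\<in>{- int R..int R} \<times> {- int R..int R}. 1 / real_of_int (max \<bar>u\<bar> \<bar>v\<bar>)) = 8 * real R"
proof (induction R)
  case (Suc R)
  let ?B = "\<lambda>R. {- int R..int R} \<times> {- int R..int R}"
  have sub: "?B R \<subseteq> ?B (Suc R)" by auto
  have "(\<Sum>(u, v)\<in>?B (Suc R). 1 / real_of_int (max \<bar>u\<bar> \<bar>v\<bar>)) =
    (\<Sum>(u, v)\<in>?B (Suc R) - ?B R. 1 / real_of_int (max \<bar>u\<bar> \<bar>v\<bar>)) + (\<Sum>(u, v)\<in>?B R. 1 / real_of_int (max \<bar>u\<bar> \<bar>v\<bar>))"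
    by (rule sum.subset_diff[OF sub]) simp
  \<comment> \<open>The new shell consists of \<open>8 (R + 1)\<close> points of norm
    \<open>R + 1\<close>, so every shell contributes exactly 8.\<close>
  also have "(\<Sum>(u, v)\<in>?B (Suc R) - ?B R. 1 / real_of_int (max \<bar>u\<bar> \<bar>v\<bar>)) = (\<Sum>(u, v)\<in>?B (Suc R) - ?B R. 1 / (real R + 1))"
  proof (rule sum.cong[OF refl])
    fix p assume p: "p \<in> ?B (Suc R) - ?B R"
    obtain u v where uv: "p = (u, v)" by force
    have "max \<bar>u\<bar> \<bar>v\<bar> = int R + 1" using p unfolding uv by auto
    then have "1 / real_of_int (max \<bar>u\<bar> \<bar>v\<bar>) = 1 / (real R + 1)" by simp
    then show "(case p of (u, v) \<Rightarrow> 1 / real_of_int (max \<bar>u\<bar> \<bar>v\<bar>)) = (case p of (u, v) \<Rightarrow> 1 / (real R + 1))"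
      unfolding uv by simp
  qed
  also have "\<dots> = real (card (?B (Suc R) - ?B R)) / (real R + 1)" by (simp add: case_prod_unfold)
  also have "card (?B (Suc R) - ?B R) = (2 * R + 3) * (2 * R + 3) - (2 * R + 1) * (2 * R + 1)"
  proof -
    have c: "card {- int k..int k} = 2 * k + 1" for k by simp
    have "card (?B (Suc R)) = (2 * R + 3) * (2 * R + 3)" "card (?B R) = (2 * R + 1) * (2 * R + 1)"
      unfolding card_cartesian_product c by (simp_all add: algebra_simps)
    then show ?thesis by (subst card_Diff_subset[OF _ sub]) simp_all
  qed
  also have "(2 * R + 3) * (2 * R + 3) - (2 * R + 1) * (2 * R + 1) = 8 * (R + 1)" by (simp add: algebra_simps)
  also have "real (8 * (R + 1)) / (real R + 1) = 8" by (simp add: field_simps)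
  finally show ?case unfolding Suc.IH by simp
qed simp

text \<open>Bound the gcd by the sum of all common divisors \<open>g\<close>. For fixed
  \<open>g\<close>, the substitution \<open>(g u, g v)\<close> cancels \<open>g\<close> against the
  norm, so each divisor of \<open>d\<close> costs at most the unweighted sum
  \<open>8 R\<close>.\<close>

lemma sum_gcd_div_max_norm_box:
  assumes d: "d > 0"
  shows "(\<Sum>(u, v)\<in>{- int R..int R} \<times> {- int R..int R} - {(0, 0)}.
      real (nat (gcd (int d) (gcd u v))) / real_of_int (max \<bar>u\<bar> \<bar>v\<bar>)) \<le> 8 * real R * real (tau d)"
proof -
  define W where "W = {- int R..int R} \<times> {- int R..int R} - {(0 :: int, 0 :: int)}"
  have finW: "finite W" by (simp add: W_def)
  have "(\<Sum>(u, v)\<in>W. real (nat (gcd (int d) (gcd u v))) / real_of_int (max \<bar>u\<bar> \<bar>v\<bar>)) \<le>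
    (\<Sum>(u, v)\<in>W. \<Sum>g | g dvd d. if int g dvd u \<and> int g dvd v then real g / real_of_int (max \<bar>u\<bar> \<bar>v\<bar>) else 0)"
  proof (rule sum_mono, clarify)
    fix u v assume "(u, v) \<in> W"
    define g where "g = nat (gcd (int d) (gcd u v))"
    have ig: "int g = gcd (int d) (gcd u v)" by (simp add: g_def)
    have "int g dvd int d" "int g dvd u" "int g dvd v" unfolding ig by (auto intro: gcd_dvd1 dvd_trans[OF gcd_dvd2])
    then have "(if int g dvd u \<and> int g dvd v then real g / real_of_int (max \<bar>u\<bar> \<bar>v\<bar>) else 0) = real g / real_of_int (max \<bar>u\<bar> \<bar>v\<bar>)"
      and gd: "g \<in> {g. g dvd d}" by auto
    then show "real (nat (gcd (int d) (gcd u v))) / real_of_int (max \<bar>u\<bar> \<bar>v\<bar>) \<le>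
       (\<Sum>g | g dvd d. if int g dvd u \<and> int g dvd v then real g / real_of_int (max \<bar>u\<bar> \<bar>v\<bar>) else 0)"
      using d member_le_sum[OF gd, of "\<lambda>g. if int g dvd u \<and> int g dvd v then real g / real_of_int (max \<bar>u\<bar> \<bar>v\<bar>) else 0"]
      unfolding g_def[symmetric] by (auto simp: less_max_iff_disj intro: divide_nonneg_nonneg)
  qed
  also have "\<dots> = (\<Sum>g | g dvd d. \<Sum>(u, v)\<in>W. if int g dvd u \<and> int g dvd v then real g / real_of_int (max \<bar>u\<bar> \<bar>v\<bar>) else 0)"
    unfolding case_prod_unfold by (rule sum.swap)
  also have "\<dots> \<le> (\<Sum>g | g dvd d. 8 * real R)"
  proof (rule sum_mono)
    fix g assume "g \<in> {g. g dvd d}"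
    then have g: "g > 0" using d by (auto intro: gr0I)
    have "(\<Sum>(u, v)\<in>W. if int g dvd u \<and> int g dvd v then real g / real_of_int (max \<bar>u\<bar> \<bar>v\<bar>) else 0) =
      (\<Sum>(u, v)\<in>{(u, v) \<in> W. int g dvd u \<and> int g dvd v}. real g / real_of_int (max \<bar>u\<bar> \<bar>v\<bar>))"
      using finW by (intro sum.mono_neutral_cong_right) (auto split: if_splits)
    also have "\<dots> = (\<Sum>(u, v)\<in>{(u, v). (int g * u, int g * v) \<in> W}. 1 / real_of_int (max \<bar>u\<bar> \<bar>v\<bar>))"
    proof (rule sum.reindex_bij_witness[where i = "\<lambda>(u, v). (int g * u, int g * v)" and j = "\<lambda>(u, v). (u div int g, v div int g)"])
      fix p assume "p \<in> {(u, v) \<in> W. int g dvd u \<and> int g dvd v}"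
      then obtain u v where p: "p = (int g * u, int g * v)" by (auto elim!: dvdE)
      have "max \<bar>int g * u\<bar> \<bar>int g * v\<bar> = int g * max \<bar>u\<bar> \<bar>v\<bar>"
        by (simp add: abs_mult max_mult_distrib_left)
      then show "(case (case p of (u, v) \<Rightarrow> (u div int g, v div int g)) of (u, v) \<Rightarrow> 1 / real_of_int (max \<bar>u\<bar> \<bar>v\<bar>)) =
          (case p of (u, v) \<Rightarrow> real g / real_of_int (max \<bar>u\<bar> \<bar>v\<bar>))"
        using g unfolding p by simp
    qed (use g in auto)
    also have "\<dots> \<le> (\<Sum>(u, v)\<in>{- int R..int R} \<times> {- int R..int R}. 1 / real_of_int (max \<bar>u\<bar> \<bar>v\<bar>))"
    proof (rule sum_mono2)
      have le: "\<bar>z\<bar> \<le> int R" if "\<bar>int g * z\<bar> \<le> int R" for z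
      proof -
        have "\<bar>z\<bar> \<le> int g * \<bar>z\<bar>" using g mult_right_mono[of 1 "int g" "\<bar>z\<bar>"] by simp
        then show ?thesis using that by (simp add: abs_mult)
      qed
      show "{(u, v). (int g * u, int g * v) \<in> W} \<subseteq> {- int R..int R} \<times> {- int R..int R}"
      proof clarify
        fix u v assume "(int g * u, int g * v) \<in> W"
        then have "\<bar>int g * u\<bar> \<le> int R" "\<bar>int g * v\<bar> \<le> int R" by (auto simp: W_def)
        then show "u \<in> {- int R..int R} \<and> v \<in> {- int R..int R}" using le[of u] le[of v] by auto
      qed
    qed auto
    finally show "(\<Sum>(u, v)\<in>W. if int g dvd u \<and> int g dvd v then real g / real_of_int (max \<bar>u\<bar> \<bar>v\<bar>) else 0) \<le> 8 * real R"
      by (simp only: sum_inverse_max_norm_box)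
  qed
  also have "\<dots> = 8 * real R * real (tau d)" by (simp add: tau_def)
  finally show ?thesis unfolding W_def .
qed

text \<open>Add the fibre estimates over all roots modulo \<open>d\<close>. The main terms combine
  to the density, and the errors that depend on the lattice vector are controlled by grouping the
  roots according to that vector.\<close>

lemma card_sq_pairs_approx:
  assumes sf: "squarefree d"
  shows "\<bar>real (card (sq_pairs N d)) - (real N)\<^sup>2 * root_density d\<bar> \<le> 35 * real (tau d) ^ 2 * (N / sqrt d + d)"
proof (cases "even d")
  case True
  have "sq_pairs N d = {}" using not_even_square_dvd[OF True] by (auto simp: sq_pairs_def)
  moreover have "d > 0" using sf by (cases "d = 0") auto
  ultimately show ?thesis using True by (simp add: root_density_even)
next
  case odd: False
  have d0: "d > 0" using sf by (cases "d = 0") auto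
  define Q where "Q = real N / d"
  have Q0: "Q \<ge> 0" by (simp add: Q_def)
  define Z where "Z = roots_on_line 0 0 d"
  define F where "F = (\<lambda>(x, y). card {(i, j). x + int d * i \<in> {1..int N} \<and> y + int d * j \<in> {1..int N} \<and>
       int d dvd 2 * x * i + 2 * y * j - (- ((x\<^sup>2 + y\<^sup>2 + 1) div int d))})"
  define R where "R = nat \<lfloor>sqrt d\<rfloor>"
  define W where "W = {- int R..int R} \<times> {- int R..int R} - {(0 :: int, 0 :: int)}"
  have "\<exists>w. w \<in> W \<and> p \<in> roots_on_line (fst w) (snd w) d \<and>
     \<bar>real (F p) - (real N)\<^sup>2 / real d ^ 3\<bar> \<le> 4 * (Q + 1) / max \<bar>fst w\<bar> \<bar>snd w\<bar> + 2 + (2 * Q + 1) / d" if "p \<in> Z" for p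
  proof -
    obtain x y where p: "p = (x, y)" by force
    have mem: "(x, y) \<in> roots_on_line 0 0 d" using that by (simp add: p Z_def)
    have Fp: "F p = card {(i, j). x + int d * i \<in> {1..int N} \<and> y + int d * j \<in> {1..int N} \<and>
       int d dvd 2 * x * i + 2 * y * j - (- ((x\<^sup>2 + y\<^sup>2 + 1) div int d))}"
      by (simp only: F_def p case_prod_conv)
    obtain u v :: int where uv: "(u, v) \<noteq> (0, 0)" "u\<^sup>2 \<le> int d" "v\<^sup>2 \<le> int d" "(x, y) \<in> roots_on_line u v d"
      "\<bar>real (F p) - (real N)\<^sup>2 / real d ^ 3\<bar> \<le> 4 * (Q + 1) / max \<bar>u\<bar> \<bar>v\<bar> + 2 + (2 * Q + 1) / d"
      unfolding Fp Q_def by (rule root_fibre_count[OF odd mem]) blast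
    have zle: "\<bar>z\<bar> \<le> int R" if "z\<^sup>2 \<le> int d" for z
    proof -
      have "(real_of_int z)\<^sup>2 \<le> real d" using that by (metis of_int_le_iff of_int_of_nat_eq of_int_power)
      then have "\<bar>real_of_int z\<bar> \<le> sqrt d" by (simp add: real_le_rsqrt)
      then have "\<bar>z\<bar> \<le> \<lfloor>sqrt d\<rfloor>" by (simp add: le_floor_iff)
      then show ?thesis by (simp add: R_def)
    qed
    have "\<bar>u\<bar> \<le> int R" "\<bar>v\<bar> \<le> int R" using zle uv(2,3) by blast+
    then have "(u, v) \<in> W" using uv(1) unfolding W_def by auto
    then show ?thesis using uv(4,5) unfolding p by (intro exI[of _ "(u, v)"]) simp
  qed
  then obtain w where w: "\<And>p. p \<in> Z \<Longrightarrow> w p \<in> W" "\<And>p. p \<in> Z \<Longrightarrow> p \<in> roots_on_line (fst (w p)) (snd (w p)) d"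
    "\<And>p. p \<in> Z \<Longrightarrow> \<bar>real (F p) - (real N)\<^sup>2 / real d ^ 3\<bar> \<le> 4 * (Q + 1) / max \<bar>fst (w p)\<bar> \<bar>snd (w p)\<bar> + 2 + (2 * Q + 1) / d"
    by metis
  have finZ: "finite Z" by (simp add: Z_def)
  have finW: "finite W" by (simp add: W_def)
  have omega: "(2 :: real) ^ card (prime_factors d) \<le> tau d"
    using two_power_card_prime_factors_le_tau[OF sf] by (metis of_nat_le_iff of_nat_numeral of_nat_power)
  have R_le: "real R \<le> sqrt d" by (simp add: R_def)
  \<comment> \<open>All roots with the same vector lie on one line modulo \<open>d\<close>, so they
    number at most \<open>tau d\<close> times the gcd of \<open>d\<close> and the vector. The sum
    over roots becomes a weighted sum over the box of side about \<open>sqrt d\<close>.\<close>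
  have "(\<Sum>p\<in>Z. 1 / real_of_int (max \<bar>fst (w p)\<bar> \<bar>snd (w p)\<bar>)) \<le> 8 * sqrt d * real (tau d) ^ 2"
  proof -
    have "(\<Sum>p\<in>Z. 1 / real_of_int (max \<bar>fst (w p)\<bar> \<bar>snd (w p)\<bar>)) =
        (\<Sum>q\<in>W. \<Sum>p | p \<in> Z \<and> w p = q. 1 / real_of_int (max \<bar>fst (w p)\<bar> \<bar>snd (w p)\<bar>))"
      using w(1) by (intro sum.group[symmetric] finZ finW) auto
    also have "\<dots> = (\<Sum>q\<in>W. real (card {p \<in> Z. w p = q}) / real_of_int (max \<bar>fst q\<bar> \<bar>snd q\<bar>))"
      by (intro sum.cong refl) simp
    also have "\<dots> \<le> (\<Sum>q\<in>W. real (tau d) * (real (nat (gcd (int d) (gcd (fst q) (snd q)))) / real_of_int (max \<bar>fst q\<bar> \<bar>snd q\<bar>)))"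
    proof (rule sum_mono)
      fix q assume "q \<in> W"
      have "card {p \<in> Z. w p = q} \<le> card (roots_on_line (fst q) (snd q) d)"
        using w(2) by (intro card_mono) auto
      also have "\<dots> \<le> 2 ^ card (prime_factors d) * nat (gcd (int d) (gcd (fst q) (snd q)))"
        by (rule card_roots_on_line_squarefree_le[OF sf])
      also have "\<dots> \<le> tau d * nat (gcd (int d) (gcd (fst q) (snd q)))"
        using two_power_card_prime_factors_le_tau[OF sf] by (rule mult_right_mono) simp
      finally have "real (card {p \<in> Z. w p = q}) \<le> real (tau d) * real (nat (gcd (int d) (gcd (fst q) (snd q))))"
        by (metis of_nat_le_iff of_nat_mult)
      then have "real (card {p \<in> Z. w p = q}) / real_of_int (max \<bar>fst q\<bar> \<bar>snd q\<bar>) \<le>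
          real (tau d) * real (nat (gcd (int d) (gcd (fst q) (snd q)))) / real_of_int (max \<bar>fst q\<bar> \<bar>snd q\<bar>)"
        by (rule divide_right_mono) simp
      then show "real (card {p \<in> Z. w p = q}) / real_of_int (max \<bar>fst q\<bar> \<bar>snd q\<bar>) \<le>
          real (tau d) * (real (nat (gcd (int d) (gcd (fst q) (snd q)))) / real_of_int (max \<bar>fst q\<bar> \<bar>snd q\<bar>))"
        by simp
    qed
    also have "\<dots> \<le> real (tau d) * (8 * real R * real (tau d))"
      using sum_gcd_div_max_norm_box[OF d0, of R] unfolding sum_distrib_left[symmetric] W_def case_prod_unfold
      by (intro mult_left_mono) simp_all
    also have "\<dots> \<le> real (tau d) * (8 * sqrt d * real (tau d))"
      using R_le by (intro mult_left_mono mult_right_mono) simp_all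
    finally show ?thesis by (simp add: power2_eq_square algebra_simps)
  qed
  then have s1: "4 * (Q + 1) * (\<Sum>p\<in>Z. 1 / real_of_int (max \<bar>fst (w p)\<bar> \<bar>snd (w p)\<bar>)) \<le> 4 * (Q + 1) * (8 * sqrt d * real (tau d) ^ 2)"
    using Q0 by (intro mult_left_mono) simp_all
  have cZ: "real (card Z) \<le> real (tau d) * real d"
  proof -
    have "card Z \<le> tau d * d"
      using card_roots_on_line_squarefree_le[OF sf, of 0 0] two_power_card_prime_factors_le_tau[OF sf]
      unfolding Z_def by (auto intro: order.trans mult_right_mono)
    then show ?thesis by (metis of_nat_le_iff of_nat_mult)
  qed
  have "real (card (sq_pairs N d)) = (\<Sum>p\<in>Z. real (F p))"
    unfolding sq_pairs_def card_square_dvd_eq_sum[OF d0] Z_def F_def by (simp add: case_prod_unfold)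
  moreover have "(real N)\<^sup>2 * root_density d = (\<Sum>p\<in>Z. (real N)\<^sup>2 / real d ^ 3)"
    unfolding root_density_odd[OF sf odd] Z_def by simp
  ultimately have "\<bar>real (card (sq_pairs N d)) - (real N)\<^sup>2 * root_density d\<bar> = \<bar>\<Sum>p\<in>Z. real (F p) - (real N)\<^sup>2 / real d ^ 3\<bar>"
    by (simp only: sum_subtractf)
  also have "\<dots> \<le> (\<Sum>p\<in>Z. 4 * (Q + 1) / max \<bar>fst (w p)\<bar> \<bar>snd (w p)\<bar> + 2 + (2 * Q + 1) / d)"
    by (rule order.trans[OF sum_abs]) (intro sum_mono w(3))
  also have "\<dots> = 4 * (Q + 1) * (\<Sum>p\<in>Z. 1 / real_of_int (max \<bar>fst (w p)\<bar> \<bar>snd (w p)\<bar>)) + card Z * (2 + (2 * Q + 1) / d)"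
    by (simp add: sum.distrib sum_distrib_left algebra_simps)
  also have "\<dots> \<le> 4 * (Q + 1) * (8 * sqrt d * real (tau d) ^ 2) + real (tau d) * real d * (2 + (2 * Q + 1) / d)"
    using Q0 by (intro add_mono s1 mult_right_mono cZ) simp
  \<comment> \<open>Here 32 is \<open>4 * 8\<close>, from the fibre error and the box sum. The term
    in \<open>d\<close> collects \<open>32 sqrt d + 3 d\<close>, which gives 35; the term in
    \<open>N / sqrt d\<close> collects only 34.\<close>
  also have "\<dots> \<le> 35 * real (tau d) ^ 2 * (N / sqrt d + d)"
  proof -
    have sd: "1 \<le> sqrt d" "sqrt d \<le> d" "sqrt d * sqrt d = real d"
      using d0 real_sqrt_le_iff by (simp_all add: real_le_lsqrt sqrt_le_D self_le_power power2_eq_square)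
    have Qs: "Q * sqrt d = N / sqrt d" using d0 by (simp add: Q_def eq_divide_eq mult.assoc)
    have QN: "Q \<le> N / sqrt d" unfolding Q_def using sd d0 by (intro divide_left_mono) simp_all
    have d1: "1 \<le> real d" using d0 by simp
    have "card {1 :: nat} \<le> tau d" unfolding tau_def using d0 by (intro card_mono) auto
    then have t1: "1 \<le> tau d" by simp
    then have t2: "real (tau d) \<le> real (tau d) ^ 2" by (simp add: self_le_power)
    have "real (tau d) * real d * (2 + (2 * Q + 1) / d) = real (tau d) * (2 * d + 2 * Q + 1)"
      using d0 by (simp add: field_simps)
    also have "\<dots> \<le> real (tau d) ^ 2 * (2 * (N / sqrt d) + 3 * d)"
      using t2 QN d1 Q0 by (intro mult_mono) simp_all
    finally have "4 * (Q + 1) * (8 * sqrt d * real (tau d) ^ 2) + real (tau d) * real d * (2 + (2 * Q + 1) / d) \<le>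
        real (tau d) ^ 2 * (32 * (Q * sqrt d) + 32 * sqrt d + (2 * (N / sqrt d) + 3 * d))"
      by (simp add: algebra_simps)
    also have "\<dots> \<le> real (tau d) ^ 2 * (35 * (N / sqrt d + d))"
    proof (rule mult_left_mono)
      have "0 \<le> N / sqrt d" by simp
      then show "32 * (Q * sqrt d) + 32 * sqrt d + (2 * (N / sqrt d) + 3 * d) \<le> 35 * (N / sqrt d + d)"
        unfolding Qs using sd(2) by (simp only: of_nat_mult of_nat_numeral) argo
    qed simp
    finally show ?thesis by (simp add: algebra_simps)
  qed
  finally show ?thesis .
qed

subsection \<open>The Euler product\<close>

lemma tau_1: "tau 1 = 1"
  by (simp add: tau_def)

lemma root_density_prime_le:
  assumes "prime p"
  shows "root_density p \<le> 2 / real p ^ 2"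
proof -
  have "tau p \<le> 2" using tau_prime_power_mult[OF assms, of 1 1] tau_1 by simp
  then have "tau p / real p ^ 2 \<le> 2 / real p ^ 2" by (intro divide_right_mono) auto
  then show ?thesis using root_density_le[of p] squarefree_prime[OF assms] by linarith
qed

lemma local_factor_eq: "local_factor n = (if prime n then 1 - root_density n else 1)"
  by (simp add: local_factor_def root_density_def)

text \<open>The factors differ from 1 by at most the summable \<open>2 / n^2\<close>, and none
  vanishes, because \<open>2 / p^2\<close> is below 1 for every prime.\<close>

lemma convergent_prod_local_factor: "convergent_prod local_factor"
proof -
  define z where "z n = (if prime n then - root_density n else 0)" for n
  have "summable (\<lambda>n. 2 * inverse (real n ^ 2))"
    by (intro summable_mult inverse_power_summable) simp
  moreover have "norm \<bar>z n\<bar> \<le> 2 * inverse (real n ^ 2)" for n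
    using root_density_prime_le[of n] by (auto simp: z_def divide_inverse)
  ultimately have "summable (\<lambda>n. \<bar>z n\<bar>)" by (rule summable_comparison_test'[where N = 0])
  moreover have "z n \<noteq> - 1" for n
  proof (cases "prime n")
    case True
    then have "2 ^ 2 \<le> real n ^ 2" using prime_ge_2_nat[OF True] by (intro power_mono) simp_all
    then have "2 / real n ^ 2 < 1" by (simp add: divide_less_eq)
    then have "root_density n < 1" using root_density_prime_le[OF True] by linarith
    then show ?thesis using True by (simp add: z_def)
  qed (simp add: z_def)
  ultimately have "convergent_prod (\<lambda>n. 1 + z n)" by (rule summable_imp_convergent_prod_real)
  moreover have "(\<lambda>n. 1 + z n) = local_factor" by (auto simp: z_def local_factor_eq)
  ultimately show ?thesis by simp
qed

definition density_term :: "nat \<Rightarrow> real" where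
  "density_term d = moebius d * root_density d"

lemma abs_density_term_le: "\<bar>density_term d\<bar> \<le> tau d / real d ^ 2"
proof (cases "squarefree d")
  case True
  then have "\<bar>density_term d\<bar> = root_density d"
    by (simp add: density_term_def moebius_def abs_mult power_abs)
  then show ?thesis using root_density_le[OF True] by simp
qed (simp add: density_term_def moebius_def)

lemma tau_div_square_le:
  assumes "\<eta> > 0" "T \<ge> 0" "\<And>n. n > 0 \<Longrightarrow> real (tau n) \<le> T * real n powr \<eta>" "d > 0"
  shows "tau d / real d ^ 2 \<le> T * real d powr (\<eta> - 2)"
proof -
  have "tau d / real d ^ 2 \<le> T * real d powr \<eta> / real d ^ 2"
    using assms by (intro divide_right_mono) auto
  also have "\<dots> = T * real d powr (\<eta> - 2)" using assms(4) by (simp add: powr_diff powr_numeral)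
  finally show ?thesis .
qed

lemma summable_abs_density_term: "summable (\<lambda>d. \<bar>density_term d\<bar>)"
proof -
  obtain T where T: "T \<ge> 1" "\<And>n. n > 0 \<Longrightarrow> real (tau n) \<le> T * real n powr (1 / 2)"
    using tau_le_powr[of "1 / 2"] by auto
  have "summable (\<lambda>d. T * real d powr (1 / 2 - 2))"
    by (intro summable_mult) (simp add: summable_real_powr_iff)
  moreover have "norm \<bar>density_term d\<bar> \<le> T * real d powr (1 / 2 - 2)" for d
  proof (cases "d = 0")
    case False
    then show ?thesis using abs_density_term_le[of d] tau_div_square_le[of "1 / 2" T d] T by force
  qed (use T in \<open>simp add: density_term_def moebius_def\<close>)
  ultimately show ?thesis by (rule summable_comparison_test'[where N = 0])
qed

text \<open>Absolute convergence permits summation along any exhausting family of finite sets. The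
  squarefree numbers with all prime factors at most \<open>n\<close> are such a family, and their
  sums are exactly the partial Euler products.\<close>

lemma density_term_sums: "density_term sums density_const"
proof -
  have sm: "summable density_term" using summable_abs_density_term by (rule summable_rabs_cancel)
  define S where "S = suminf density_term"
  define Sq where "Sq = {d :: nat. squarefree d}"
  define D where "D n = {d. squarefree d \<and> prime_factors d \<subseteq> {p. p \<le> n \<and> prime p}}" for n :: nat
  have "(density_term has_sum S) UNIV"
    using summable_abs_density_term sm unfolding S_def
    by (intro norm_summable_imp_has_sum) (auto simp: summable_sums)
  also have "?this \<longleftrightarrow> (density_term has_sum S) Sq"
    by (rule has_sum_cong_neutral) (auto simp: Sq_def density_term_def moebius_def)
  finally have lim: "(sum density_term \<longlongrightarrow> S) (finite_subsets_at_top Sq)" by (simp only: has_sum_def)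
  have finD: "finite (D n)" for n
    unfolding D_def
    by (rule iffD1[OF bij_betw_finite[OF bij_betw_Prod_squarefree]]) simp_all
  \<comment> \<open>A finite set of squarefree numbers lies in \<open>D n\<close> once
    \<open>n\<close> exceeds its maximum, since prime factors are no larger than the number.\<close>
  have "filterlim D (finite_subsets_at_top Sq) sequentially"
    unfolding filterlim_iff eventually_finite_subsets_at_top
  proof (intro allI impI, elim exE conjE)
    fix P X assume X: "finite X" "X \<subseteq> Sq" and P: "\<forall>Y. finite Y \<and> X \<subseteq> Y \<and> Y \<subseteq> Sq \<longrightarrow> P Y"
    show "\<forall>\<^sub>F n in sequentially. P (D n)"
      unfolding eventually_sequentially
    proof (intro exI[of _ "Max (insert 0 X)"] allI impI)
      fix n assume n: "Max (insert 0 X) \<le> n"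
      have "X \<subseteq> D n"
      proof
        fix d assume d: "d \<in> X"
        then have "d \<le> Max (insert 0 X)" using X(1) by (intro Max_ge) simp_all
        then have "d \<le> n" using n by (rule order.trans)
        have "squarefree d" using d X(2) by (auto simp: Sq_def)
        then have "d > 0" by (cases "d = 0") simp_all
        have "prime_factors d \<subseteq> {p. p \<le> n \<and> prime p}"
        proof
          fix p assume p: "p \<in> prime_factors d"
          then have "p \<le> d" using \<open>d > 0\<close> by (intro dvd_imp_le in_prime_factors_imp_dvd)
          then show "p \<in> {p. p \<le> n \<and> prime p}"
            using \<open>d \<le> n\<close> in_prime_factors_imp_prime[OF p] by simp
        qed
        with \<open>squarefree d\<close> show "d \<in> D n" unfolding D_def by blast
      qed
      moreover have "D n \<subseteq> Sq" by (auto simp: D_def Sq_def)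
      ultimately show "P (D n)" using P finD by blast
    qed
  qed
  then have "(\<lambda>n. sum density_term (D n)) \<longlonglongrightarrow> S" by (rule filterlim_compose[OF lim])
  moreover have "sum density_term (D n) = (\<Prod>i\<le>n. local_factor i)" for n
  proof -
    have "sum density_term (D n) = (\<Sum>d\<in>D n. moebius d * (\<Prod>p\<in>prime_factors d. root_density p))"
      by (intro sum.cong refl) (simp add: density_term_def root_density_prod[symmetric] D_def)
    also have "\<dots> = (\<Prod>p | p \<le> n \<and> prime p. 1 - root_density p)"
      unfolding D_def by (rule sum_moebius_mult_dvd) auto
    also have "\<dots> = (\<Prod>i\<le>n. local_factor i)"
      by (rule prod.mono_neutral_cong_left) (auto simp: local_factor_eq)
    finally show ?thesis .
  qed
  ultimately have "(\<lambda>n. \<Prod>i\<le>n. local_factor i) \<longlonglongrightarrow> S" by simp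
  moreover have "(\<lambda>n. \<Prod>i\<le>n. local_factor i) \<longlonglongrightarrow> density_const"
    unfolding density_const_def by (rule convergent_prod_LIMSEQ[OF convergent_prod_local_factor])
  ultimately have "S = density_const" by (rule LIMSEQ_unique)
  then show ?thesis using summable_sums[OF sm] unfolding S_def by simp
qed

subsection \<open>Large square divisors\<close>

lemma sq_pairs_nat:
  "card (sq_pairs N d) = card {(x :: nat, y :: nat). x \<in> {1..N} \<and> y \<in> {1..N} \<and> d\<^sup>2 dvd x\<^sup>2 + y\<^sup>2 + 1}"
proof (rule bij_betw_same_card[symmetric], rule bij_betwI[where f = "\<lambda>(x, y). (int x, int y)" and g = "\<lambda>(x, y). (nat x, nat y)"])
  have iff: "(int d)\<^sup>2 dvd (int x)\<^sup>2 + (int y)\<^sup>2 + 1 \<longleftrightarrow> d\<^sup>2 dvd x\<^sup>2 + y\<^sup>2 + 1" for x y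
  proof -
    have "(int d)\<^sup>2 dvd (int x)\<^sup>2 + (int y)\<^sup>2 + 1 \<longleftrightarrow> int (d\<^sup>2) dvd int (x\<^sup>2 + y\<^sup>2 + 1)" by (simp add: ac_simps)
    then show ?thesis by (simp only: int_dvd_int_iff)
  qed
  show "(\<lambda>(x, y). (int x, int y)) \<in> {(x, y). x \<in> {1..N} \<and> y \<in> {1..N} \<and> d\<^sup>2 dvd x\<^sup>2 + y\<^sup>2 + 1} \<rightarrow> sq_pairs N d"
  proof (rule Pi_I)
    fix p assume "p \<in> {(x, y). x \<in> {1..N} \<and> y \<in> {1..N} \<and> d\<^sup>2 dvd x\<^sup>2 + y\<^sup>2 + 1}"
    then show "(\<lambda>(x, y). (int x, int y)) p \<in> sq_pairs N d"
      unfolding sq_pairs_def by (cases p) (simp add: iff)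
  qed
  show "(\<lambda>(x, y). (nat x, nat y)) \<in> sq_pairs N d \<rightarrow> {(x, y). x \<in> {1..N} \<and> y \<in> {1..N} \<and> d\<^sup>2 dvd x\<^sup>2 + y\<^sup>2 + 1}"
  proof (rule Pi_I)
    fix p assume p: "p \<in> sq_pairs N d"
    obtain x y where xy: "p = (x, y)" by force
    have "x = int (nat x)" "y = int (nat y)" using p unfolding xy sq_pairs_def by simp_all
    moreover have "nat x \<in> {1..N}" "nat y \<in> {1..N}" using p unfolding xy sq_pairs_def by auto
    ultimately show "(\<lambda>(x, y). (nat x, nat y)) p \<in> {(x, y). x \<in> {1..N} \<and> y \<in> {1..N} \<and> d\<^sup>2 dvd x\<^sup>2 + y\<^sup>2 + 1}"
      using p iff[of "nat x" "nat y"] unfolding xy sq_pairs_def by simp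
  qed
qed (auto simp: sq_pairs_def)

lemma sum_squares_le:
  assumes "x \<in> {1..N}" "y \<in> {1..N :: nat}"
  shows "x\<^sup>2 + y\<^sup>2 + 1 \<le> 3 * N\<^sup>2"
proof -
  have "x\<^sup>2 \<le> N\<^sup>2" "y\<^sup>2 \<le> N\<^sup>2" using assms by (auto intro: power_mono)
  moreover have "1 \<le> N\<^sup>2" using assms by (simp add: Suc_le_eq)
  ultimately show ?thesis by linarith
qed

text \<open>Insert the divisor-sum formula for the squared Moebius function and exchange sums. As
  \<open>d^2 \<le> 3 N^2 \<le> (2 N)^2\<close>, the range up to \<open>2 N\<close> contains every
  relevant \<open>d\<close>, uniformly in \<open>(x, y)\<close>.\<close>

lemma sqfree_sum_eq:
  assumes "H \<ge> 0"
  shows "sqfree_sum H = (\<Sum>d\<in>{1..2 * nat \<lfloor>H\<rfloor>}. moebius d * real (card (sq_pairs (nat \<lfloor>H\<rfloor>) d)))"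
proof -
  define N where "N = nat \<lfloor>H\<rfloor>"
  define B where "B = {1..N} \<times> {1..N}"
  have box: "{(x, y). 1 \<le> x \<and> real x \<le> H \<and> 1 \<le> y \<and> real y \<le> H} = B"
  proof -
    have le: "real x \<le> H \<longleftrightarrow> x \<le> N" for x using assms by (simp add: N_def le_nat_iff le_floor_iff)
    show ?thesis unfolding le B_def by auto
  qed
  have "sqfree_sum H = (\<Sum>(x, y)\<in>B. \<Sum>d\<in>{1..2 * N}. if d\<^sup>2 dvd x\<^sup>2 + y\<^sup>2 + 1 then real_of_int (moebius d) else 0)"
    unfolding sqfree_sum_def box
  proof (rule sum.cong[OF refl], clarify)
    fix x y assume "(x, y) \<in> B"
    then have xy: "x \<in> {1..N}" "y \<in> {1..N}" by (auto simp: B_def)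
    have "{d. d\<^sup>2 dvd x\<^sup>2 + y\<^sup>2 + 1} = {d \<in> {1..2 * N}. d\<^sup>2 dvd x\<^sup>2 + y\<^sup>2 + 1}"
    proof -
      have "d \<in> {1..2 * N}" if dv: "d\<^sup>2 dvd x\<^sup>2 + y\<^sup>2 + 1" for d
      proof -
        have "d\<^sup>2 \<le> x\<^sup>2 + y\<^sup>2 + 1" using dv by (rule dvd_imp_le) simp
        also have "\<dots> \<le> 3 * N\<^sup>2" using xy by (rule sum_squares_le)
        also have "\<dots> \<le> (2 * N)\<^sup>2" by (simp add: power_mult_distrib)
        finally have "d \<le> 2 * N" by (simp only: power2_nat_le_eq_le)
        moreover have "d \<noteq> 0" using dv by (intro notI) simp
        ultimately show ?thesis by simp
      qed
      then show ?thesis by blast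
    qed
    then have "real_of_int ((moebius (x\<^sup>2 + y\<^sup>2 + 1))\<^sup>2) = (\<Sum>d | d \<in> {1..2 * N} \<and> d\<^sup>2 dvd x\<^sup>2 + y\<^sup>2 + 1. real_of_int (moebius d))"
      using moebius_square_sum[of "x\<^sup>2 + y\<^sup>2 + 1"] by simp
    also have "\<dots> = (\<Sum>d\<in>{1..2 * N}. if d\<^sup>2 dvd x\<^sup>2 + y\<^sup>2 + 1 then real_of_int (moebius d) else 0)"
      by (rule sum.inter_filter) simp
    finally show "real_of_int ((moebius (x\<^sup>2 + y\<^sup>2 + 1))\<^sup>2) = (\<Sum>d\<in>{1..2 * N}. if d\<^sup>2 dvd x\<^sup>2 + y\<^sup>2 + 1 then real_of_int (moebius d) else 0)" .
  qed
  also have "\<dots> = (\<Sum>d\<in>{1..2 * N}. \<Sum>(x, y)\<in>B. if d\<^sup>2 dvd x\<^sup>2 + y\<^sup>2 + 1 then real_of_int (moebius d) else 0)"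
    unfolding case_prod_unfold by (rule sum.swap)
  also have "\<dots> = (\<Sum>d\<in>{1..2 * N}. moebius d * real (card (sq_pairs N d)))"
  proof (rule sum.cong[OF refl])
    fix d
    have "(\<Sum>(x, y)\<in>B. if d\<^sup>2 dvd x\<^sup>2 + y\<^sup>2 + 1 then real_of_int (moebius d) else 0) =
        (\<Sum>p\<in>{p \<in> B. d\<^sup>2 dvd (fst p)\<^sup>2 + (snd p)\<^sup>2 + 1}. real_of_int (moebius d))"
      unfolding case_prod_unfold by (rule sum.inter_filter[symmetric]) (simp add: B_def)
    also have "{p \<in> B. d\<^sup>2 dvd (fst p)\<^sup>2 + (snd p)\<^sup>2 + 1} = {(x, y). x \<in> {1..N} \<and> y \<in> {1..N} \<and> d\<^sup>2 dvd x\<^sup>2 + y\<^sup>2 + 1}"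
      unfolding B_def by auto
    finally show "(\<Sum>(x, y)\<in>B. if d\<^sup>2 dvd x\<^sup>2 + y\<^sup>2 + 1 then real_of_int (moebius d) else 0) = moebius d * real (card (sq_pairs N d))"
      unfolding sq_pairs_nat by (simp add: mult.commute)
  qed
  finally show ?thesis unfolding N_def .
qed

lemma card_sq_pairs_le:
  assumes "\<eta> > 0"
  obtains C where "C \<ge> 0" "\<And>N d. N > 0 \<Longrightarrow> d > 0 \<Longrightarrow> real (card (sq_pairs N d)) \<le> C * real N powr (2 + \<eta>) / real d ^ 2"
proof -
  \<comment> \<open>The exponent is \<open>\<eta> / 4\<close> because the divisor bound is squared
    and is applied to numbers as large as \<open>3 N^2\<close>; each of these doubles it.\<close>
  obtain T where T: "T \<ge> 1" "\<And>n. n > 0 \<Longrightarrow> real (tau n) \<le> T * real n powr (\<eta> / 4)"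
    using tau_le_powr[of "\<eta> / 4"] assms by auto
  define C where "C = 3 * (T\<^sup>2 * 3 powr (\<eta> / 2))"
  have bound: "real (card (sq_pairs N d)) \<le> C * real N powr (2 + \<eta>) / real d ^ 2" if N: "N > 0" and d: "d > 0" for N d
  proof -
    define R where "R n = {(x :: nat, y :: nat). x > 0 \<and> y > 0 \<and> x\<^sup>2 + y\<^sup>2 = n}" for n
    define k where "k = 3 * N\<^sup>2 div d\<^sup>2"
    have finR: "finite (R n)" for n
    proof (rule finite_subset[of _ "{..n} \<times> {..n}"])
      have "x \<le> x\<^sup>2" for x :: nat by (cases "x = 0") (simp_all add: power2_eq_square)
      then show "R n \<subseteq> {..n} \<times> {..n}" unfolding R_def by (auto intro: le_trans trans_le_add1 trans_le_add2)
    qed simp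
    have "card (sq_pairs N d) \<le> card (\<Union>i\<in>{1..k}. {p \<in> R (i * d\<^sup>2 - 1). i * d\<^sup>2 \<le> 3 * N\<^sup>2})"
      unfolding sq_pairs_nat
    proof (rule card_mono)
      show "finite (\<Union>i\<in>{1..k}. {p \<in> R (i * d\<^sup>2 - 1). i * d\<^sup>2 \<le> 3 * N\<^sup>2})" using finR by simp
      show "{(x, y). x \<in> {1..N} \<and> y \<in> {1..N} \<and> d\<^sup>2 dvd x\<^sup>2 + y\<^sup>2 + 1} \<subseteq>
          (\<Union>i\<in>{1..k}. {p \<in> R (i * d\<^sup>2 - 1). i * d\<^sup>2 \<le> 3 * N\<^sup>2})"
      proof (rule subsetI)
        fix p assume p: "p \<in> {(x, y). x \<in> {1..N} \<and> y \<in> {1..N} \<and> d\<^sup>2 dvd x\<^sup>2 + y\<^sup>2 + 1}"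
        obtain x y where xy: "p = (x, y)" by force
        have mem: "x \<in> {1..N}" "y \<in> {1..N}" and dv: "d\<^sup>2 dvd x\<^sup>2 + y\<^sup>2 + 1" using p unfolding xy by auto
        obtain i where i: "x\<^sup>2 + y\<^sup>2 + 1 = d\<^sup>2 * i" using dv by (rule dvdE)
        have le: "d\<^sup>2 * i \<le> 3 * N\<^sup>2" using sum_squares_le[OF mem] by (simp only: i)
        have "i * d\<^sup>2 \<le> 3 * N\<^sup>2" using le by (simp add: mult.commute)
        then have "i \<le> k" unfolding k_def using d by (simp add: less_eq_div_iff_mult_less_eq)
        moreover have "i \<noteq> 0" using i by (intro notI) simp
        moreover have "p \<in> R (i * d\<^sup>2 - 1)"
        proof -
          have "x\<^sup>2 + y\<^sup>2 = i * d\<^sup>2 - 1" using i by (simp add: mult.commute)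
          then show ?thesis using mem unfolding xy R_def by simp
        qed
        ultimately show "p \<in> (\<Union>i\<in>{1..k}. {p \<in> R (i * d\<^sup>2 - 1). i * d\<^sup>2 \<le> 3 * N\<^sup>2})"
          using le by (intro UN_I[of i]) (simp_all add: mult.commute)
      qed
    qed
    also have "\<dots> \<le> (\<Sum>i\<in>{1..k}. card {p \<in> R (i * d\<^sup>2 - 1). i * d\<^sup>2 \<le> 3 * N\<^sup>2})" by (rule card_UN_le) simp
    finally have "real (card (sq_pairs N d)) \<le> real (\<Sum>i\<in>{1..k}. card {p \<in> R (i * d\<^sup>2 - 1). i * d\<^sup>2 \<le> 3 * N\<^sup>2})"
      by (simp only: of_nat_le_iff)
    also have "\<dots> = (\<Sum>i\<in>{1..k}. real (card {p \<in> R (i * d\<^sup>2 - 1). i * d\<^sup>2 \<le> 3 * N\<^sup>2}))"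
      by (rule of_nat_sum)
    also have "\<dots> \<le> (\<Sum>i\<in>{1..k}. T\<^sup>2 * 3 powr (\<eta> / 2) * real N powr \<eta>)"
    proof (rule sum_mono)
      fix i assume i: "i \<in> {1..k}"
      show "real (card {p \<in> R (i * d\<^sup>2 - 1). i * d\<^sup>2 \<le> 3 * N\<^sup>2}) \<le> T\<^sup>2 * 3 powr (\<eta> / 2) * real N powr \<eta>"
      proof (cases "i * d\<^sup>2 \<le> 3 * N\<^sup>2 \<and> i * d\<^sup>2 - 1 > 0")
        case True
        define n where "n = i * d\<^sup>2 - 1"
        have n: "n > 0" "n \<le> 3 * N\<^sup>2" using True unfolding n_def by linarith+
        have "card {p \<in> R n. i * d\<^sup>2 \<le> 3 * N\<^sup>2} \<le> card (R n)" by (rule card_mono[OF finR]) blast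
        also have "\<dots> \<le> (tau n)\<^sup>2" unfolding R_def by (rule card_reps_le[OF n(1)])
        finally have "real (card {p \<in> R n. i * d\<^sup>2 \<le> 3 * N\<^sup>2}) \<le> real ((tau n)\<^sup>2)" by (simp only: of_nat_le_iff)
        also have "\<dots> = (real (tau n))\<^sup>2" by simp
        also have "\<dots> \<le> (T * real n powr (\<eta> / 4))\<^sup>2" using T(2)[OF n(1)] by (intro power_mono) simp_all
        also have "\<dots> \<le> (T * (3 * (real N)\<^sup>2) powr (\<eta> / 4))\<^sup>2"
        proof -
          have "real n \<le> real (3 * N\<^sup>2)" using n(2) by (simp only: of_nat_le_iff)
          then have "real n \<le> 3 * (real N)\<^sup>2" by simp
          then have "real n powr (\<eta> / 4) \<le> (3 * (real N)\<^sup>2) powr (\<eta> / 4)" using assms by (intro powr_mono2) simp_all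
          then show ?thesis using T(1) by (intro power_mono mult_left_mono) simp_all
        qed
        also have "\<dots> = T\<^sup>2 * 3 powr (\<eta> / 2) * real N powr \<eta>"
        proof -
          have "((3 * (real N)\<^sup>2) powr (\<eta> / 4))\<^sup>2 = (3 * (real N)\<^sup>2) powr (\<eta> / 2)"
            by (simp add: power2_eq_square powr_add[symmetric])
          also have "\<dots> = 3 powr (\<eta> / 2) * ((real N)\<^sup>2) powr (\<eta> / 2)" by (simp add: powr_mult)
          also have "((real N)\<^sup>2) powr (\<eta> / 2) = real N powr \<eta>"
            using powr_powr[of "real N" 2 "\<eta> / 2"] N by (simp add: powr_numeral)
          finally show ?thesis by (simp add: power_mult_distrib)
        qed
        finally show ?thesis unfolding n_def .
      next
        \<comment> \<open>The case \<open>i * d^2 = 1\<close> asks for representations of 0 by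
          positive squares, of which there are none; the divisor bound is thus applied only to
          positive \<open>n\<close>.\<close>
        case False
        have "{p \<in> R (i * d\<^sup>2 - 1). i * d\<^sup>2 \<le> 3 * N\<^sup>2} = {}"
        proof (cases "i * d\<^sup>2 \<le> 3 * N\<^sup>2")
          case True
          then have "i * d\<^sup>2 - 1 = 0" using False by simp
          then show ?thesis unfolding R_def by auto
        qed simp
        then have "card {p \<in> R (i * d\<^sup>2 - 1). i * d\<^sup>2 \<le> 3 * N\<^sup>2} = 0" by (simp only: card.empty)
        then show ?thesis by simp
      qed
    qed
    also have "\<dots> = real k * (T\<^sup>2 * 3 powr (\<eta> / 2) * real N powr \<eta>)" by simp
    also have "\<dots> \<le> 3 * (real N)\<^sup>2 / real d ^ 2 * (T\<^sup>2 * 3 powr (\<eta> / 2) * real N powr \<eta>)"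
    proof (rule mult_right_mono)
      have "real k \<le> real (3 * N\<^sup>2) / real (d\<^sup>2)" unfolding k_def by (rule of_nat_div_le_of_nat)
      then show "real k \<le> 3 * (real N)\<^sup>2 / real d ^ 2" by simp
    qed simp
    also have "\<dots> = C * ((real N)\<^sup>2 * real N powr \<eta>) / real d ^ 2" by (simp add: C_def)
    also have "(real N)\<^sup>2 * real N powr \<eta> = real N powr (2 + \<eta>)" using N by (simp add: powr_add powr_numeral)
    finally show ?thesis .
  qed
  show ?thesis by (rule that[of C]) (use bound in \<open>auto simp: C_def\<close>)
qed

subsection \<open>The asymptotic formula\<close>

text \<open>Sums of powers of \<open>d\<close> on either side of the cut \<open>Z\<close> thus reduce to one convergent series.\<close>

lemma powr_split_le:
  fixes d Z a \<eta> :: real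
  assumes "d > 0" and "(0 \<le> a + 1 + \<eta> \<and> d \<le> Z) \<or> (a + 1 + \<eta> \<le> 0 \<and> 0 < Z \<and> Z \<le> d)"
  shows "d powr a \<le> Z powr (a + 1 + \<eta>) * d powr (- 1 - \<eta>)"
proof -
  have "d powr a = d powr (a + 1 + \<eta>) * d powr (- 1 - \<eta>)" by (simp add: powr_add[symmetric])
  moreover have "d powr (a + 1 + \<eta>) \<le> Z powr (a + 1 + \<eta>)"
    using assms by (auto intro: powr_mono2 powr_mono2')
  ultimately show ?thesis by (simp add: mult_right_mono)
qed

lemma sqfree_sum_approx:
  assumes \<eta>: "0 < \<eta>" "\<eta> \<le> 1 / 4"
  shows "\<exists>C. \<forall>H\<ge>1. \<bar>sqfree_sum H - density_const * H\<^sup>2\<bar> \<le> C * H powr (4 / 3 + 2 * \<eta>)"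
proof -
  obtain T where T: "T \<ge> 1" "\<And>n. n > 0 \<Longrightarrow> real (tau n) \<le> T * real n powr \<eta>"
    using tau_le_powr[OF \<eta>(1)] by blast
  obtain K where K: "K \<ge> 0" "\<And>N d. N > 0 \<Longrightarrow> d > 0 \<Longrightarrow> real (card (sq_pairs N d)) \<le> K * real N powr (2 + \<eta>) / real d ^ 2"
    using card_sq_pairs_le[OF \<eta>(1)] by blast
  \<comment> \<open>A summable weight: each estimate below is brought to a constant times
    \<open>H powr (4 / 3 + 2 * \<eta>) * w d\<close>, so that summing over any range of
    \<open>d\<close> costs only the constant \<open>Z\<close>.\<close>
  define w where "w d = real d powr (- 1 - \<eta>)" for d :: nat
  have w0: "w d \<ge> 0" for d by (simp add: w_def)
  have wsum: "summable w" unfolding w_def using \<eta> by (simp add: summable_real_powr_iff)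
  define Z where "Z = suminf w"
  have Z: "sum w A \<le> Z" if "finite A" for A
    unfolding Z_def using sum_le_suminf[OF wsum that] w0 by simp
  have Z0: "Z \<ge> 0" using Z[of "{}"] by simp
  \<comment> \<open>The four summands belong to the error for small \<open>d\<close>, the count for
    large \<open>d\<close>, the tail of the density series, and the replacement of \<open>N\<close>
    by \<open>H\<close>.\<close>
  define C where "C = 70 * T\<^sup>2 * Z + K * Z + T * Z + 2 * \<bar>density_const\<bar>"
  have "\<bar>sqfree_sum H - density_const * H\<^sup>2\<bar> \<le> C * H powr (4 / 3 + 2 * \<eta>)" if H: "H \<ge> 1" for H
  proof -
    define N where "N = nat \<lfloor>H\<rfloor>"
    define y where "y = H powr (2 / 3)"
    define M where "M = nat \<lfloor>y\<rfloor>"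
    define B where "B = H powr (4 / 3 + 2 * \<eta>)"
    have N: "real N \<le> H" "H - 1 \<le> real N" "N > 0" using H unfolding N_def by (auto simp: le_nat_iff)
    have y1: "y \<ge> 1" using H unfolding y_def by (intro ge_one_powr_ge_zero) auto
    have yH: "y \<le> H" using powr_mono[of "2 / 3" 1 H] H by (simp add: y_def)
    have M_le: "real M \<le> y" and M_gt: "y < real M + 1" using y1 unfolding M_def by linarith+
    have MN: "M \<le> N" using yH unfolding M_def N_def by (intro nat_mono floor_mono)
    have ypow: "y powr a = H powr (2 / 3 * a)" for a unfolding y_def by (simp add: powr_powr)
    have Hpow: "H * H powr a = H powr (1 + a)" for a using H by (simp add: powr_add)
    have Hpow2: "H powr a * (H powr b * z) = H powr (a + b) * z" for a b z by (simp add: powr_add)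
    have HB: "H powr a \<le> B" if "a \<le> 4 / 3 + 2 * \<eta>" for a using H that unfolding B_def by (intro powr_mono)
    have B0: "B \<ge> 0" by (simp add: B_def)
    define e where "e d = moebius d * real (card (sq_pairs N d)) - (real N)\<^sup>2 * density_term d" for d
    \<comment> \<open>Both parts reach the exponent \<open>4/3 + 2 \<eta>\<close> exactly: the
      squared divisor bound contributes \<open>2 \<eta>\<close> and the weight one more
      \<open>\<eta>\<close>, and \<open>d \<le> H powr (2/3)\<close> turns \<open>3 \<eta>\<close>
      into \<open>2 \<eta>\<close>. The constant 70 is \<open>2 * 35\<close>.\<close>
    have small: "\<bar>e d\<bar> \<le> 70 * T\<^sup>2 * B * w d" if d: "d \<in> {1..M}" for d
    proof (cases "squarefree d")
      case True
      have d0: "real d > 0" "d > 0" and dy: "real d \<le> y" using d M_le by auto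
      have "\<bar>e d\<bar> = \<bar>real_of_int (moebius d)\<bar> * \<bar>real (card (sq_pairs N d)) - (real N)\<^sup>2 * root_density d\<bar>"
        unfolding e_def density_term_def abs_mult[symmetric] by (simp add: algebra_simps)
      also have "\<bar>real_of_int (moebius d)\<bar> = 1" using True by (simp add: moebius_def power_abs)
      also have "1 * \<bar>real (card (sq_pairs N d)) - (real N)\<^sup>2 * root_density d\<bar> \<le> 35 * real (tau d) ^ 2 * (N / sqrt d + d)"
        using card_sq_pairs_approx[OF True, of N] by simp
      also have "\<dots> \<le> 35 * (T * real d powr \<eta>) ^ 2 * (H / sqrt d + d)"
        using T(2)[OF d0(2)] N(1) by (intro mult_mono power_mono add_mono divide_right_mono) simp_all
      also have "\<dots> = 35 * T\<^sup>2 * (H * real d powr (2 * \<eta> - 1 / 2) + real d powr (2 * \<eta> + 1))"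
      proof -
        have p: "(real d powr \<eta>)\<^sup>2 = real d powr (2 * \<eta>)" by (simp add: power2_eq_square powr_add[symmetric])
        have q: "real d powr (2 * \<eta> - 1 / 2) = real d powr (2 * \<eta>) / sqrt d"
          using d0 by (simp add: powr_diff powr_half_sqrt)
        have r: "real d powr (2 * \<eta> + 1) = real d powr (2 * \<eta>) * d" using d0 by (simp add: powr_add)
        show ?thesis unfolding power_mult_distrib p q r by (simp add: algebra_simps)
      qed
      also have "\<dots> \<le> 35 * T\<^sup>2 * (B * w d + B * w d)"
      proof (intro mult_left_mono add_mono)
        have "real d powr (2 * \<eta> - 1 / 2) \<le> y powr (2 * \<eta> - 1 / 2 + 1 + \<eta>) * real d powr (- 1 - \<eta>)"
          using d0 dy \<eta> by (intro powr_split_le) auto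
        then have "H * real d powr (2 * \<eta> - 1 / 2) \<le> H * (y powr (2 * \<eta> - 1 / 2 + 1 + \<eta>) * w d)"
          unfolding w_def using H by (intro mult_left_mono) auto
        also have "\<dots> = H powr (1 + 2 / 3 * (2 * \<eta> - 1 / 2 + 1 + \<eta>)) * w d"
          unfolding ypow by (simp only: Hpow mult.assoc[symmetric])
        also have "\<dots> \<le> B * w d" using \<eta> by (intro mult_right_mono HB w0) (simp add: field_simps)
        finally show "H * real d powr (2 * \<eta> - 1 / 2) \<le> B * w d" .
        have "real d powr (2 * \<eta> + 1) \<le> y powr (2 * \<eta> + 1 + 1 + \<eta>) * real d powr (- 1 - \<eta>)"
          using d0 dy \<eta> by (intro powr_split_le) auto
        also have "\<dots> \<le> B * w d"
          unfolding ypow w_def[symmetric] using \<eta> by (intro mult_right_mono HB w0) (simp add: field_simps)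
        finally show "real d powr (2 * \<eta> + 1) \<le> B * w d" .
      qed simp
      finally show ?thesis by (simp add: algebra_simps)
    next
      case False
      then have "e d = 0" by (simp add: e_def density_term_def moebius_def)
      then show ?thesis using B0 w0[of d] by simp
    qed
    have large: "real (card (sq_pairs N d)) \<le> K * B * w d" if d: "M < d" for d
    proof -
      have d0: "d > 0" and dy: "y \<le> real d" using d M_gt by auto
      have "real (card (sq_pairs N d)) \<le> K * real N powr (2 + \<eta>) / real d ^ 2" by (rule K(2)[OF N(3) d0])
      also have "\<dots> = K * (real N powr (2 + \<eta>) * real d powr (- 2))"
        using d0 by (simp add: powr_minus powr_numeral divide_inverse)
      also have "\<dots> \<le> K * (H powr (2 + \<eta>) * (y powr (- 2 + 1 + \<eta>) * real d powr (- 1 - \<eta>)))"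
        using d0 dy y1 \<eta> N K(1) by (intro mult_left_mono mult_mono powr_mono2 powr_split_le) auto
      also have "\<dots> = K * (H powr (2 + \<eta> + 2 / 3 * (- 2 + 1 + \<eta>)) * w d)"
        unfolding ypow w_def by (simp only: Hpow2)
      also have "\<dots> \<le> K * (B * w d)"
        using \<eta> K(1) by (intro mult_left_mono mult_right_mono HB w0) (simp_all add: field_simps)
      finally show ?thesis by simp
    qed
    have dens: "(real N)\<^sup>2 * \<bar>density_term d\<bar> \<le> T * B * w d" if d: "M < d" for d
    proof -
      have d0: "d > 0" and dy: "y \<le> real d" using d M_gt by auto
      have "\<bar>density_term d\<bar> \<le> T * real d powr (\<eta> - 2)"
        using abs_density_term_le[of d] tau_div_square_le[OF \<eta>(1) _ T(2) d0] T(1) by force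
      also have "\<dots> \<le> T * (y powr (\<eta> - 2 + 1 + \<eta>) * real d powr (- 1 - \<eta>))"
        using d0 dy y1 \<eta> T(1) by (intro mult_left_mono powr_split_le) auto
      finally have "(real N)\<^sup>2 * \<bar>density_term d\<bar> \<le> H powr 2 * (T * (y powr (\<eta> - 2 + 1 + \<eta>) * w d))"
        using N H unfolding w_def by (intro mult_mono) (auto simp: powr_numeral intro: power_mono)
      also have "\<dots> = T * (H powr (2 + 2 / 3 * (\<eta> - 2 + 1 + \<eta>)) * w d)"
        unfolding ypow by (simp only: Hpow2 mult.left_commute[of _ T])
      also have "\<dots> \<le> T * (B * w d)"
        using \<eta> T(1) by (intro mult_left_mono mult_right_mono HB w0) (simp_all add: field_simps)
      finally show ?thesis by simp
    qed
    have split: "{1..2 * N} = {1..M} \<union> {M + 1..2 * N}" using MN by auto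
    have S: "sqfree_sum H = (\<Sum>d\<in>{1..M}. moebius d * real (card (sq_pairs N d))) +
        (\<Sum>d\<in>{M + 1..2 * N}. moebius d * real (card (sq_pairs N d)))"
      using sqfree_sum_eq[of H] H unfolding N_def[symmetric] split by (simp add: sum.union_disjoint)
    have tail: "(\<Sum>i. density_term (i + (M + 1))) = density_const - (\<Sum>d\<in>{1..M}. density_term d)"
    proof -
      have "(\<Sum>i. density_term (i + (M + 1))) = suminf density_term - (\<Sum>d<M + 1. density_term d)"
        using density_term_sums by (intro suminf_minus_initial_segment) (simp add: sums_iff)
      \<comment> \<open>The index 0 contributes nothing, because 0 is not squarefree.\<close>
      moreover have "(\<Sum>d<M + 1. density_term d) = (\<Sum>d\<in>{1..M}. density_term d)"
        by (rule sum.mono_neutral_right) (auto simp: density_term_def moebius_def not_le)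
      ultimately show ?thesis using density_term_sums by (simp add: sums_iff)
    qed
    have t1: "\<bar>\<Sum>d\<in>{1..M}. e d\<bar> \<le> 70 * T\<^sup>2 * B * Z"
    proof -
      have "\<bar>\<Sum>d\<in>{1..M}. e d\<bar> \<le> (\<Sum>d\<in>{1..M}. 70 * T\<^sup>2 * B * w d)"
        by (rule order.trans[OF sum_abs]) (intro sum_mono small)
      also have "\<dots> = 70 * T\<^sup>2 * B * sum w {1..M}" by (simp only: sum_distrib_left)
      also have "\<dots> \<le> 70 * T\<^sup>2 * B * Z" using B0 by (intro mult_left_mono Z) auto
      finally show ?thesis .
    qed
    have t2: "\<bar>\<Sum>d\<in>{M + 1..2 * N}. moebius d * real (card (sq_pairs N d))\<bar> \<le> K * B * Z"
    proof -
      have "\<bar>\<Sum>d\<in>{M + 1..2 * N}. moebius d * real (card (sq_pairs N d))\<bar> \<le> (\<Sum>d\<in>{M + 1..2 * N}. K * B * w d)"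
      proof (rule order.trans[OF sum_abs], rule sum_mono)
        fix d assume d: "d \<in> {M + 1..2 * N}"
        have "\<bar>real_of_int (moebius d)\<bar> \<le> 1" by (simp add: moebius_def power_abs)
        then have "\<bar>moebius d * real (card (sq_pairs N d))\<bar> \<le> real (card (sq_pairs N d))"
          unfolding abs_mult by (simp add: mult_left_le_one_le)
        also have "\<dots> \<le> K * B * w d" using d by (intro large) simp
        finally show "\<bar>moebius d * real (card (sq_pairs N d))\<bar> \<le> K * B * w d" .
      qed
      also have "\<dots> = K * B * sum w {M + 1..2 * N}" by (simp only: sum_distrib_left)
      also have "\<dots> \<le> K * B * Z" using B0 K(1) by (intro mult_left_mono Z) auto
      finally show ?thesis .
    qed
    have t3: "\<bar>(real N)\<^sup>2 * (\<Sum>i. density_term (i + (M + 1)))\<bar> \<le> T * B * Z"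
    proof -
      have sa: "summable (\<lambda>i. \<bar>density_term (i + (M + 1))\<bar>)"
        using summable_abs_density_term by (rule summable_ignore_initial_segment)
      have sw: "summable (\<lambda>i. w (i + (M + 1)))" using wsum by (rule summable_ignore_initial_segment)
      have "\<bar>(real N)\<^sup>2 * (\<Sum>i. density_term (i + (M + 1)))\<bar> \<le> (real N)\<^sup>2 * (\<Sum>i. \<bar>density_term (i + (M + 1))\<bar>)"
        unfolding abs_mult using summable_rabs[OF sa] by (simp add: mult_left_mono)
      also have "\<dots> = (\<Sum>i. (real N)\<^sup>2 * \<bar>density_term (i + (M + 1))\<bar>)" using sa by (rule suminf_mult[symmetric])
      also have "\<dots> \<le> (\<Sum>i. T * B * w (i + (M + 1)))"
        using sa sw by (intro suminf_le dens summable_mult) auto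
      also have "\<dots> = T * B * (\<Sum>i. w (i + (M + 1)))" using sw by (rule suminf_mult)
      also have "\<dots> \<le> T * B * Z"
      proof (rule mult_left_mono)
        have "(\<Sum>i. w (i + (M + 1))) = Z - sum w {..<M + 1}"
          unfolding Z_def using wsum by (rule suminf_minus_initial_segment)
        then show "(\<Sum>i. w (i + (M + 1))) \<le> Z" using sum_nonneg[of "{..<M + 1}" w] w0 by simp
      qed (use T(1) B0 in simp)
      finally show ?thesis .
    qed
    \<comment> \<open>\<open>N\<close> is the integer part of \<open>H\<close>, so
      \<open>H^2 - N^2\<close> is at most \<open>2 H\<close>, well within the error.\<close>
    have t4: "\<bar>density_const * ((real N)\<^sup>2 - H\<^sup>2)\<bar> \<le> 2 * \<bar>density_const\<bar> * B"
    proof -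
      have "\<bar>(real N)\<^sup>2 - H\<^sup>2\<bar> = (H - real N) * (H + real N)" using N H
        by (simp add: power2_eq_square algebra_simps mult_mono)
      also have "\<dots> \<le> 1 * (2 * H)" using N H by (intro mult_mono) auto
      also have "H \<le> B" using HB[of 1] H \<eta> by simp
      finally show ?thesis unfolding abs_mult by (simp add: mult_left_mono mult.assoc mult.left_commute)
    qed
    have "sqfree_sum H - density_const * H\<^sup>2 = (\<Sum>d\<in>{1..M}. e d) +
        (\<Sum>d\<in>{M + 1..2 * N}. moebius d * real (card (sq_pairs N d))) -
        (real N)\<^sup>2 * (\<Sum>i. density_term (i + (M + 1))) + density_const * ((real N)\<^sup>2 - H\<^sup>2)"
      unfolding S tail e_def sum_subtractf sum_distrib_left[symmetric] by (simp add: algebra_simps)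
    then have "\<bar>sqfree_sum H - density_const * H\<^sup>2\<bar> \<le> 70 * T\<^sup>2 * B * Z + K * B * Z + T * B * Z + 2 * \<bar>density_const\<bar> * B"
      using t1 t2 t3 t4 by linarith
    also have "\<dots> = C * B" unfolding C_def by (simp add: algebra_simps)
    finally show ?thesis unfolding B_def .
  qed
  then show ?thesis by blast
qed

theorem theorem1:
  "convergent_prod local_factor \<and>
   (\<exists>H0 > 0. \<forall>\<epsilon> > 0. \<exists>C. \<forall>H \<ge> H0.
      \<bar>sqfree_sum H - density_const * H\<^sup>2\<bar> \<le> C * H powr (4 / 3 + \<epsilon>))"
proof (rule conjI[OF convergent_prod_local_factor], rule exI[of _ 1], intro conjI allI impI)
  fix \<epsilon> :: real assume \<epsilon>: "\<epsilon> > 0"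
  \<comment> \<open>The cap \<open>1/4\<close> meets the requirement of
    \<open>sqfree_sum_approx\<close> for large \<open>\<epsilon>\<close>; the threshold
    \<open>H0 = 1\<close> does not depend on \<open>\<epsilon>\<close>.\<close>
  define \<eta> where "\<eta> = min (\<epsilon> / 2) (1 / 4)"
  have \<eta>: "0 < \<eta>" "\<eta> \<le> 1 / 4" "2 * \<eta> \<le> \<epsilon>" using \<epsilon> by (auto simp: \<eta>_def)
  obtain C where C: "\<And>H. H \<ge> 1 \<Longrightarrow> \<bar>sqfree_sum H - density_const * H\<^sup>2\<bar> \<le> C * H powr (4 / 3 + 2 * \<eta>)"
    using sqfree_sum_approx[OF \<eta>(1,2)] by blast
  show "\<exists>C. \<forall>H\<ge>1. \<bar>sqfree_sum H - density_const * H\<^sup>2\<bar> \<le> C * H powr (4 / 3 + \<epsilon>)"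
  \<comment> \<open>The sign of \<open>C\<close> is unknown, and enlarging the power of
    \<open>H\<close> requires a nonnegative factor.\<close>
  proof (intro exI[of _ "\<bar>C\<bar>"] allI impI)
    fix H :: real assume H: "H \<ge> 1"
    have "\<bar>sqfree_sum H - density_const * H\<^sup>2\<bar> \<le> C * H powr (4 / 3 + 2 * \<eta>)" by (rule C[OF H])
    also have "\<dots> \<le> \<bar>C\<bar> * H powr (4 / 3 + \<epsilon>)" using H \<eta>(3) by (intro mult_mono powr_mono) auto
    finally show "\<bar>sqfree_sum H - density_const * H\<^sup>2\<bar> \<le> \<bar>C\<bar> * H powr (4 / 3 + \<epsilon>)" .
  qed
qed simp

end
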